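(* For any program $N$ we have $\mathcal M[\![N]\!]=\mathcal M[\![\mathrm{Op}(N)]\!]$.
   Context: **Syntax.** Fix a set of base types $b$ (including $\mathtt{Bool}$); constants $c:b$ of base types (including $\mathtt{tt},\mathtt{ff}:\mathtt{Bool}$); function symbols $f:b_1\ldots b_m\to b$ (including $=_b\,:b\,b\to\mathtt{Bool}$ for each $b$); and algebraic operation symbols $op:b_1\ldots b_n;m$ (parameter base types $b_1,\dots,b_n$, arity $m\in\mathbb N$). Types: $\sigma::=b\mid\mathtt{Unit}\mid\sigma\times\sigma\mid\sigma\to\sigma$. Terms: $M::=x\mid c\mid f(M_1,\dots,M_m)\mid\mathtt{if}\,L\,\mathtt{then}\,M\,\mathtt{else}\,N\mid op(N_1,\dots,N_n;M_1,\dots,M_m)\mid *\mid\langle M,N\rangle\mid\mathtt{fst}(M)\mid\mathtt{snd}(M)\mid\lambda x{:}\sigma.M\mid MN$, up to $\alpha$-equivalence, with standard simple typing; $op(N_1,\dots,N_n;M_1,\dots,M_m)$ has type $\sigma$ when $N_j:b_j$ and all $M_i:\sigma$. Programs are closed well-typed terms. **Operational semantics.** Values: $V::=c\mid *\mid\langle V,W\rangle\mid\lambda x{:}\sigma.M$ (closed). Effect values: $E::=V\mid op(c_1,\dots,c_n;E_1,\dots,E_m)$. Evaluation contexts (closed): $\mathcal E::=[\,]\mid f(c_1,\dots,c_{k-1},\mathcal E,M_{k+1},\dots,M_m)\mid\mathtt{if}\,\mathcal E\,\mathtt{then}\,M\,\mathtt{else}\,N\mid op(c_1,\dots,c_{k-1},\mathcal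 E,N_{k+1},\dots,N_n;M_1,\dots,M_m)\mid\langle\mathcal E,N\rangle\mid\langle V,\mathcal E\rangle\mid\mathtt{fst}(\mathcal E)\mid\mathtt{snd}(\mathcal E)\mid\mathcal E N\mid(\lambda x{:}\sigma.M)\mathcal E$. For each $f:b_1\ldots b_m\to b$ and constants $c_i:b_i$ a constant $\mathrm{val}_f(c_1,\dots,c_m):b$ is given, with $\mathrm{val}_{=_b}(c,c')=\mathtt{tt}$ if $c=c'$ and $\mathtt{ff}$ otherwise. Ordinary steps $\mathcal E[Q]\to\mathcal E[Q']$ arise from $f(c_1,\dots,c_m)\to\mathrm{val}_f(c_1,\dots,c_m)$; $\mathtt{if}\,\mathtt{tt}\,\mathtt{then}\,M\,\mathtt{else}\,N\to M$; $\mathtt{if}\,\mathtt{ff}\,\mathtt{then}\,M\,\mathtt{else}\,N\to N$; $\mathtt{fst}\langle V,W\rangle\to V$; $\mathtt{snd}\langle V,W\rangle\to W$; $(\lambda x{:}\sigma.M)V\to M[V/x]$. Each program is exactly one of: a value; a program with a unique ordinary step; or uniquely of the form $\mathcal E[op(c_1,\dots,c_n;M_1,\dots,M_m)]$; all transition sequences (where in the last case one passes to any $\mathcal E[M_i]$) terminate. The effect value $\mathrm{Op}(M)$ of a program is thus determined by: $\mathrm{Op}(V)=V$; $\mathrm{Op}(M)=\mathrm{Op}(M')$ if $M\to M'$; $\mathrm{Op}(\mathcal E[op(c_1,\dots,c_n;M_1,\dots,M_m)])=op(c_1,\dots,c_n;\mathrm{Op}(\mathcal E[M_1]),\dots,\mathrm{Op}(\mathcal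 E[M_m]))$. **Denotational semantics.** Given are: a (necessarily strong) monad $\mathcal{T}$ on sets (unit $\eta$, Kleisli extension $(-)^\dagger$); nonempty sets $[\![b]\!]$ with $[\![\mathtt{Bool}]\!]=\{0,1\}$; elements $[\![c]\!]\in[\![b]\!]$ for $c:b$, with $[\![\mathtt{tt}]\!]=1$, $[\![\mathtt{ff}]\!]=0$ and distinct constants of the same type having distinct denotations; functions $[\![f]\!]:[\![b_1]\!]\times\cdots\times[\![b_m]\!]\to[\![b]\!]$ with $[\![f]\!]([\![c_1]\!],\dots,[\![c_m]\!])=[\![\mathrm{val}_f(c_1,\dots,c_m)]\!]$; and generic effects $g_{op}:[\![b_1]\!]\times\cdots\times[\![b_n]\!]\to\mathcal T(\{0,\dots,m-1\})$ for each $op:b_1\ldots b_n;m$. The latter induce operations $op_X(o,(u_0,\dots,u_{m-1}))=(i\mapsto u_i)^\dagger(g_{op}(o))$ on $\mathcal T(X)$. Types denote: $\mathcal M[\![b]\!]=[\![b]\!]$, $\mathcal M[\![\mathtt{Unit}]\!]=\{*\}$, $\mathcal M[\![\sigma\times\tau]\!]=\mathcal M[\![\sigma]\!]\times\mathcal M[\![\tau]\!]$, $\mathcal M[\![\sigma\to\tau]\!]=\mathcal M[\![\sigma]\!]\to\mathcal T(\mathcal M[\![\tau]\!])$. A term $\Gamma\vdash M:\sigma$ denotes a function $\mathcal M[\![M]\!]:\mathcal M[\![\Gamma]\!]\to\mathcal T(\mathcal M[\![\sigma]\!])$ by the standard left-to-right call-by-value monadic semantics: $\mathcal M[\![x]\!](\rho)=\eta(\rho(x))$,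 $\mathcal M[\![c]\!](\rho)=\eta([\![c]\!])$, $\mathcal M[\![*]\!](\rho)=\eta( * )$, $\mathcal M[\![\lambda x{:}\sigma.M]\!](\rho)=\eta(a\mapsto\mathcal M[\![M]\!](\rho,a))$; pairs, projections, applications and function-symbol applications sequence their arguments left to right by Kleisli extension and then apply the evident function (for $f$, the function $[\![f]\!]$ followed by $\eta$); conditionals sequence the condition and then branch; and $\mathcal M[\![op(N_1,\dots,N_n;M_1,\dots,M_m)]\!](\rho)$ sequences $\mathcal M[\![N_1]\!](\rho),\dots,\mathcal M[\![N_n]\!](\rho)$ left to right to obtain parameters $o$ and then returns $op_X(o,(\mathcal M[\![M_1]\!](\rho),\dots,\mathcal M[\![M_m]\!](\rho)))$ with $X=\mathcal M[\![\sigma]\!]$. *)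

theory Defs
  imports Main "HOL-Library.FuncSet"
begin

section \<open>Syntax\<close>

datatype 'b ty = BaseT 'b | UnitT | ProdT "'b ty" "'b ty" | FunT "'b ty" "'b ty"

text \<open>Terms up to \<open>\<alpha>\<close>-equivalence are represented with de Bruijn indices.
  In \<open>Op p Ns Ms\<close>, \<open>Ns\<close> are the parameters and \<open>Ms\<close> the arguments.\<close>

datatype ('b, 'c, 'f, 'o) tm =
    Var nat
  | Const 'c
  | FApp 'f "('b, 'c, 'f, 'o) tm list"
  | Cond "('b, 'c, 'f, 'o) tm" "('b, 'c, 'f, 'o) tm" "('b, 'c, 'f, 'o) tm"
  | Op 'o "('b, 'c, 'f, 'o) tm list" "('b, 'c, 'f, 'o) tm list"
  | Star
  | Pair "('b, 'c, 'f, 'o) tm" "('b, 'c, 'f, 'o) tm"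
  | Fst "('b, 'c, 'f, 'o) tm"
  | Snd "('b, 'c, 'f, 'o) tm"
  | Lam "'b ty" "('b, 'c, 'f, 'o) tm"
  | App "('b, 'c, 'f, 'o) tm" "('b, 'c, 'f, 'o) tm"

record ('b, 'c, 'f, 'o) signature =
  boolT :: 'b
  constT :: "'c \<Rightarrow> 'b"
  ttC :: 'c
  ffC :: 'c
  funArgs :: "'f \<Rightarrow> 'b list"
  funRes :: "'f \<Rightarrow> 'b"
  eqF :: "'b \<Rightarrow> 'f"
  funVal :: "'f \<Rightarrow> 'c list \<Rightarrow> 'c"
  opPars :: "'o \<Rightarrow> 'b list"
  opArity :: "'o \<Rightarrow> nat"

locale language =
  fixes S :: "('b, 'c, 'f, 'o) signature"
  assumes tt_type: "constT S (ttC S) = boolT S"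
    and ff_type: "constT S (ffC S) = boolT S"
    and eq_args: "funArgs S (eqF S b) = [b, b]"
    and eq_res: "funRes S (eqF S b) = boolT S"
    and val_type: "map (constT S) cs = funArgs S f \<Longrightarrow> constT S (funVal S f cs) = funRes S f"
    and val_eq: "constT S c = b \<Longrightarrow> constT S c' = b \<Longrightarrow>
      funVal S (eqF S b) [c, c'] = (if c = c' then ttC S else ffC S)"

text \<open>A context lists the types of the de Bruijn indices \<open>0, 1, \<dots>\<close>. A term can have several
  types, since an operation of arity \<open>0\<close> has every type.\<close>

inductive typing ::
  "('b, 'c, 'f, 'o) signature \<Rightarrow> 'b ty list \<Rightarrow> ('b, 'c, 'f, 'o) tm \<Rightarrow> 'b ty \<Rightarrow> bool"
  for S where
  ty_Var: "i < length \<Gamma> \<Longrightarrow> typing S \<Gamma> (Var i) (\<Gamma> ! i)"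
| ty_Const: "typing S \<Gamma> (Const c) (BaseT (constT S c))"
| ty_FApp: "list_all2 (\<lambda>M b. typing S \<Gamma> M (BaseT b)) Ms (funArgs S f) \<Longrightarrow>
    typing S \<Gamma> (FApp f Ms) (BaseT (funRes S f))"
| ty_Cond: "typing S \<Gamma> L (BaseT (boolT S)) \<Longrightarrow> typing S \<Gamma> M \<sigma> \<Longrightarrow> typing S \<Gamma> N \<sigma> \<Longrightarrow>
    typing S \<Gamma> (Cond L M N) \<sigma>"
| ty_Op: "list_all2 (\<lambda>N b. typing S \<Gamma> N (BaseT b)) Ns (opPars S p) \<Longrightarrow>
    length Ms = opArity S p \<Longrightarrow> (\<forall>M \<in> set Ms. typing S \<Gamma> M \<sigma>) \<Longrightarrow>
    typing S \<Gamma> (Op p Ns Ms) \<sigma>"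
| ty_Star: "typing S \<Gamma> Star UnitT"
| ty_Pair: "typing S \<Gamma> M \<sigma> \<Longrightarrow> typing S \<Gamma> N \<tau> \<Longrightarrow> typing S \<Gamma> (Pair M N) (ProdT \<sigma> \<tau>)"
| ty_Fst: "typing S \<Gamma> M (ProdT \<sigma> \<tau>) \<Longrightarrow> typing S \<Gamma> (Fst M) \<sigma>"
| ty_Snd: "typing S \<Gamma> M (ProdT \<sigma> \<tau>) \<Longrightarrow> typing S \<Gamma> (Snd M) \<tau>"
| ty_Lam: "typing S (\<sigma> # \<Gamma>) M \<tau> \<Longrightarrow> typing S \<Gamma> (Lam \<sigma> M) (FunT \<sigma> \<tau>)"
| ty_App: "typing S \<Gamma> M (FunT \<sigma> \<tau>) \<Longrightarrow> typing S \<Gamma> N \<sigma> \<Longrightarrow> typing S \<Gamma> (App M N) \<tau>"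


section \<open>Operational semantics\<close>

primrec lift :: "nat \<Rightarrow> ('b, 'c, 'f, 'o) tm \<Rightarrow> ('b, 'c, 'f, 'o) tm" where
  "lift k (Var i) = Var (if i < k then i else Suc i)"
| "lift k (Const c) = Const c"
| "lift k (FApp f Ms) = FApp f (map (lift k) Ms)"
| "lift k (Cond L M N) = Cond (lift k L) (lift k M) (lift k N)"
| "lift k (Op p Ns Ms) = Op p (map (lift k) Ns) (map (lift k) Ms)"
| "lift k Star = Star"
| "lift k (Pair M N) = Pair (lift k M) (lift k N)"
| "lift k (Fst M) = Fst (lift k M)"
| "lift k (Snd M) = Snd (lift k M)"
| "lift k (Lam \<sigma> M) = Lam \<sigma> (lift (Suc k) M)"
| "lift k (App M N) = App (lift k M) (lift k N)"

text \<open>\<open>subst M k P\<close> replaces index \<open>k\<close> of \<open>M\<close> by \<open>P\<close> and removes this index.\<close>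

primrec subst ::
  "('b, 'c, 'f, 'o) tm \<Rightarrow> nat \<Rightarrow> ('b, 'c, 'f, 'o) tm \<Rightarrow> ('b, 'c, 'f, 'o) tm" where
  "subst (Var i) k P = (if i < k then Var i else if i = k then P else Var (i - 1))"
| "subst (Const c) k P = Const c"
| "subst (FApp f Ms) k P = FApp f (map (\<lambda>M. subst M k P) Ms)"
| "subst (Cond L M N) k P = Cond (subst L k P) (subst M k P) (subst N k P)"
| "subst (Op p Ns Ms) k P = Op p (map (\<lambda>N. subst N k P) Ns) (map (\<lambda>M. subst M k P) Ms)"
| "subst Star k P = Star"
| "subst (Pair M N) k P = Pair (subst M k P) (subst N k P)"
| "subst (Fst M) k P = Fst (subst M k P)"
| "subst (Snd M) k P = Snd (subst M k P)"
| "subst (Lam \<sigma> M) k P = Lam \<sigma> (subst M (Suc k) (lift 0 P))"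
| "subst (App M N) k P = App (subst M k P) (subst N k P)"

text \<open>Values and evaluation contexts are closed in the mathematics. Closedness is not imposed here:
  the relations below are only used on programs, where it is automatic because the hole of an
  evaluation context is never under a binder.\<close>

inductive is_value :: "('b, 'c, 'f, 'o) tm \<Rightarrow> bool" where
  "is_value (Const c)"
| "is_value Star"
| "is_value V \<Longrightarrow> is_value W \<Longrightarrow> is_value (Pair V W)"
| "is_value (Lam \<sigma> M)"

datatype ('b, 'c, 'f, 'o) ectx =
    Hole
  | EFApp 'f "'c list" "('b, 'c, 'f, 'o) ectx" "('b, 'c, 'f, 'o) tm list"
  | ECond "('b, 'c, 'f, 'o) ectx" "('b, 'c, 'f, 'o) tm" "('b, 'c, 'f, 'o) tm"
  | EOp 'o "'c list" "('b, 'c, 'f, 'o) ectx"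
      "('b, 'c, 'f, 'o) tm list" "('b, 'c, 'f, 'o) tm list"
  | EPairL "('b, 'c, 'f, 'o) ectx" "('b, 'c, 'f, 'o) tm"
  | EPairR "('b, 'c, 'f, 'o) tm" "('b, 'c, 'f, 'o) ectx"
  | EFst "('b, 'c, 'f, 'o) ectx"
  | ESnd "('b, 'c, 'f, 'o) ectx"
  | EAppL "('b, 'c, 'f, 'o) ectx" "('b, 'c, 'f, 'o) tm"
  | EAppR "'b ty" "('b, 'c, 'f, 'o) tm" "('b, 'c, 'f, 'o) ectx"

text \<open>The grammar requires the left component in \<open>EPairR\<close> to be a value.\<close>

primrec is_ectx :: "('b, 'c, 'f, 'o) ectx \<Rightarrow> bool" where
  "is_ectx Hole = True"
| "is_ectx (EFApp f cs C Ms) = is_ectx C"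
| "is_ectx (ECond C M N) = is_ectx C"
| "is_ectx (EOp p cs C Ns Ms) = is_ectx C"
| "is_ectx (EPairL C N) = is_ectx C"
| "is_ectx (EPairR V C) = (is_value V \<and> is_ectx C)"
| "is_ectx (EFst C) = is_ectx C"
| "is_ectx (ESnd C) = is_ectx C"
| "is_ectx (EAppL C N) = is_ectx C"
| "is_ectx (EAppR \<sigma> M C) = is_ectx C"

primrec fill :: "('b, 'c, 'f, 'o) ectx \<Rightarrow> ('b, 'c, 'f, 'o) tm \<Rightarrow> ('b, 'c, 'f, 'o) tm" where
  "fill Hole Q = Q"
| "fill (EFApp f cs C Ms) Q = FApp f (map Const cs @ fill C Q # Ms)"
| "fill (ECond C M N) Q = Cond (fill C Q) M N"
| "fill (EOp p cs C Ns Ms) Q = Op p (map Const cs @ fill C Q # Ns) Ms"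
| "fill (EPairL C N) Q = Pair (fill C Q) N"
| "fill (EPairR V C) Q = Pair V (fill C Q)"
| "fill (EFst C) Q = Fst (fill C Q)"
| "fill (ESnd C) Q = Snd (fill C Q)"
| "fill (EAppL C N) Q = App (fill C Q) N"
| "fill (EAppR \<sigma> M C) Q = App (Lam \<sigma> M) (fill C Q)"

inductive redex ::
  "('b, 'c, 'f, 'o) signature \<Rightarrow> ('b, 'c, 'f, 'o) tm \<Rightarrow> ('b, 'c, 'f, 'o) tm \<Rightarrow> bool"
  for S where
  "map (constT S) cs = funArgs S f \<Longrightarrow> redex S (FApp f (map Const cs)) (Const (funVal S f cs))"
| "redex S (Cond (Const (ttC S)) M N) M"
| "redex S (Cond (Const (ffC S)) M N) N"
| "is_value V \<Longrightarrow> is_value W \<Longrightarrow> redex S (Fst (Pair V W)) V"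
| "is_value V \<Longrightarrow> is_value W \<Longrightarrow> redex S (Snd (Pair V W)) W"
| "is_value V \<Longrightarrow> redex S (App (Lam \<sigma> M) V) (subst M 0 V)"

inductive step ::
  "('b, 'c, 'f, 'o) signature \<Rightarrow> ('b, 'c, 'f, 'o) tm \<Rightarrow> ('b, 'c, 'f, 'o) tm \<Rightarrow> bool"
  for S where
  "is_ectx C \<Longrightarrow> redex S Q Q' \<Longrightarrow> step S (fill C Q) (fill C Q')"

text \<open>\<open>eff_eval S M E\<close> is the graph of the recursive specification of effect values;
  \<open>effect_value S M\<close> is the \<open>E\<close> it determines.\<close>

inductive eff_eval ::
  "('b, 'c, 'f, 'o) signature \<Rightarrow> ('b, 'c, 'f, 'o) tm \<Rightarrow> ('b, 'c, 'f, 'o) tm \<Rightarrow> bool"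
  for S where
  "is_value V \<Longrightarrow> eff_eval S V V"
| "step S M M' \<Longrightarrow> eff_eval S M' E \<Longrightarrow> eff_eval S M E"
| "is_ectx C \<Longrightarrow> list_all2 (\<lambda>M E. eff_eval S (fill C M) E) Ms Es \<Longrightarrow>
    eff_eval S (fill C (Op p (map Const cs) Ms)) (Op p (map Const cs) Es)"

definition effect_value ::
  "('b, 'c, 'f, 'o) signature \<Rightarrow> ('b, 'c, 'f, 'o) tm \<Rightarrow> ('b, 'c, 'f, 'o) tm" where
  "effect_value S M = (THE E. eff_eval S M E)"


section \<open>Monads on sets\<close>

text \<open>Sets are subsets of a type \<open>'u\<close>. The sets \<open>T X\<close> are subsets of a possibly different type
  \<open>'t\<close>, so that \<open>T\<close> is not restricted in size (for the powerset monad, \<open>T UNIV\<close> does not embed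
  into \<open>'u\<close>). \<open>ext M X Y f\<close> is the Kleisli extension of \<open>f : X \<rightarrow> T Y\<close>; functions are total in HOL,
  so \<open>ext_cong\<close> says that only the restriction of \<open>f\<close> to \<open>X\<close> matters.\<close>

record ('u, 't) set_monad =
  T :: "'u set \<Rightarrow> 't set"
  eta :: "'u set \<Rightarrow> 'u \<Rightarrow> 't"
  ext :: "'u set \<Rightarrow> 'u set \<Rightarrow> ('u \<Rightarrow> 't) \<Rightarrow> 't \<Rightarrow> 't"

locale monad_on_sets =
  fixes M :: "('u, 't, 'z) set_monad_scheme"
  assumes eta_closed: "x \<in> X \<Longrightarrow> eta M X x \<in> T M X"
    and ext_closed: "f \<in> X \<rightarrow> T M Y \<Longrightarrow> t \<in> T M X \<Longrightarrow> ext M X Y f t \<in> T M Y"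
    and ext_cong: "f \<in> X \<rightarrow> T M Y \<Longrightarrow> (\<And>x. x \<in> X \<Longrightarrow> f x = g x) \<Longrightarrow> t \<in> T M X \<Longrightarrow>
      ext M X Y f t = ext M X Y g t"
    and ext_eta: "t \<in> T M X \<Longrightarrow> ext M X X (eta M X) t = t"
    and eta_ext: "f \<in> X \<rightarrow> T M Y \<Longrightarrow> x \<in> X \<Longrightarrow> ext M X Y f (eta M X x) = f x"
    and ext_ext: "f \<in> X \<rightarrow> T M Y \<Longrightarrow> g \<in> Y \<rightarrow> T M Z \<Longrightarrow> t \<in> T M X \<Longrightarrow>
      ext M Y Z g (ext M X Y f t) = ext M X Z (\<lambda>x. ext M Y Z g (f x)) t"


section \<open>Denotational semantics\<close>

text \<open>There is no HOL type of all sets, so the elements of all \<open>\<M>\<lbrakk>\<sigma>\<rbrakk>\<close> live in one type \<open>'u\<close>, in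
  which natural numbers, the point of the unit type, pairs, and functions into the sets \<open>T X\<close> are
  coded by \<open>num\<close>, \<open>pt\<close>, \<open>pair\<close> and \<open>fn\<close>; the codings are injective where they are used. A function
  \<open>X \<rightarrow> T Y\<close> is represented by the corresponding element of \<open>X \<rightarrow>\<^sub>E T Y\<close>.\<close>

record ('b, 'c, 'f, 'o, 'u, 't) model = "('u, 't) set_monad" +
  num :: "nat \<Rightarrow> 'u"
  pt :: 'u
  pair :: "'u \<Rightarrow> 'u \<Rightarrow> 'u"
  fn :: "('u \<Rightarrow> 't) \<Rightarrow> 'u"
  base :: "'b \<Rightarrow> 'u set"
  constD :: "'c \<Rightarrow> 'u"
  funD :: "'f \<Rightarrow> 'u list \<Rightarrow> 'u"
  gen :: "'o \<Rightarrow> 'u list \<Rightarrow> 't"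

primrec tyD :: "('b, 'c, 'f, 'o, 'u, 't) model \<Rightarrow> 'b ty \<Rightarrow> 'u set" where
  "tyD I (BaseT b) = base I b"
| "tyD I UnitT = {pt I}"
| "tyD I (ProdT \<sigma> \<tau>) = {pair I x y | x y. x \<in> tyD I \<sigma> \<and> y \<in> tyD I \<tau>}"
| "tyD I (FunT \<sigma> \<tau>) = fn I ` (tyD I \<sigma> \<rightarrow>\<^sub>E T I (tyD I \<tau>))"

definition numerals_below :: "('b, 'c, 'f, 'o, 'u, 't) model \<Rightarrow> nat \<Rightarrow> 'u set" where
  "numerals_below I m = num I ` {..<m}"

locale set_model = language S + monad_on_sets I
  for S :: "('b, 'c, 'f, 'o) signature"
  and I :: "('b, 'c, 'f, 'o, 'u, 't) model" +
  assumes num_inj: "inj (num I)"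
    and pair_inj: "inj (\<lambda>(x, y). pair I x y)"
    and fn_inj: "inj_on (fn I) (tyD I \<sigma> \<rightarrow>\<^sub>E T I (tyD I \<tau>))"
    and base_nonempty: "base I b \<noteq> {}"
    and base_bool: "base I (boolT S) = {num I 0, num I 1}"
    and const_closed: "constD I c \<in> base I (constT S c)"
    and const_tt: "constD I (ttC S) = num I 1"
    and const_ff: "constD I (ffC S) = num I 0"
    and const_distinct: "constT S c = constT S c' \<Longrightarrow> c \<noteq> c' \<Longrightarrow> constD I c \<noteq> constD I c'"
    and fun_closed: "list_all2 (\<lambda>x b. x \<in> base I b) xs (funArgs S f) \<Longrightarrow>
      funD I f xs \<in> base I (funRes S f)"
    and fun_val: "map (constT S) cs = funArgs S f \<Longrightarrow>
      funD I f (map (constD I) cs) = constD I (funVal S f cs)"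
    and gen_closed: "list_all2 (\<lambda>x b. x \<in> base I b) xs (opPars S p) \<Longrightarrow>
      gen I p xs \<in> T I (numerals_below I (opArity S p))"

definition fstD :: "('b, 'c, 'f, 'o, 'u, 't) model \<Rightarrow> 'u \<Rightarrow> 'u" where
  "fstD I z = fst (inv (\<lambda>(x, y). pair I x y) z)"

definition sndD :: "('b, 'c, 'f, 'o, 'u, 't) model \<Rightarrow> 'u \<Rightarrow> 'u" where
  "sndD I z = snd (inv (\<lambda>(x, y). pair I x y) z)"

definition appD ::
  "('b, 'c, 'f, 'o, 'u, 't) model \<Rightarrow> 'b ty \<Rightarrow> 'b ty \<Rightarrow> 'u \<Rightarrow> 'u \<Rightarrow> 't" where
  "appD I \<sigma> \<tau> h = the_inv_into (tyD I \<sigma> \<rightarrow>\<^sub>E T I (tyD I \<tau>)) (fn I) h"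

text \<open>The operation on \<open>T X\<close> induced by the generic effect.\<close>

definition opD ::
  "('b, 'c, 'f, 'o) signature \<Rightarrow> ('b, 'c, 'f, 'o, 'u, 't) model \<Rightarrow>
    'o \<Rightarrow> 'u set \<Rightarrow> 'u list \<Rightarrow> 't list \<Rightarrow> 't" where
  "opD S I p X xs us =
    ext I (numerals_below I (opArity S p)) X (\<lambda>i. us ! inv (num I) i) (gen I p xs)"

definition bindD ::
  "('b, 'c, 'f, 'o, 'u, 't) model \<Rightarrow> 'u set \<Rightarrow> 'u set \<Rightarrow> 't \<Rightarrow> ('u \<Rightarrow> 't) \<Rightarrow> 't" where
  "bindD I X Y t k = ext I X Y k t"

text \<open>Left-to-right sequencing of computations \<open>t\<^sub>i \<in> T X\<^sub>i\<close>, given as a list of pairs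
  \<open>(X\<^sub>i, t\<^sub>i)\<close>, with continuation into \<open>T Y\<close>.\<close>

primrec bindsD ::
  "('b, 'c, 'f, 'o, 'u, 't) model \<Rightarrow> ('u set \<times> 't) list \<Rightarrow> 'u set \<Rightarrow> ('u list \<Rightarrow> 't) \<Rightarrow> 't" where
  "bindsD I [] Y k = k []"
| "bindsD I (Xt # Xts) Y k =
    bindD I (fst Xt) Y (snd Xt) (\<lambda>x. bindsD I Xts Y (\<lambda>xs. k (x # xs)))"

text \<open>\<open>tmD S I M \<Gamma> \<sigma> \<rho>\<close> is \<open>\<M>\<lbrakk>\<Gamma> \<turnstile> M : \<sigma>\<rbrakk>(\<rho>)\<close>. The type is an argument because a term can have
  several types. For \<open>Fst\<close>, \<open>Snd\<close> and \<open>App\<close> the type of a subterm need not be determined by that of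
  the term (only because of operations of arity \<open>0\<close>); some type from a typing derivation is used,
  and the choice does not affect the result. The value is irrelevant if \<open>\<Gamma> \<turnstile> M : \<sigma>\<close> is not
  derivable.\<close>

primrec tmD ::
  "('b, 'c, 'f, 'o) signature \<Rightarrow> ('b, 'c, 'f, 'o, 'u, 't) model \<Rightarrow> ('b, 'c, 'f, 'o) tm \<Rightarrow>
    'b ty list \<Rightarrow> 'b ty \<Rightarrow> 'u list \<Rightarrow> 't" where
  "tmD S I (Var i) = (\<lambda>\<Gamma> \<sigma> \<rho>. eta I (tyD I \<sigma>) (\<rho> ! i))"
| "tmD S I (Const c) = (\<lambda>\<Gamma> \<sigma> \<rho>. eta I (tyD I \<sigma>) (constD I c))"
| "tmD S I (FApp f Ms) = (\<lambda>\<Gamma> \<sigma> \<rho>.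
    bindsD I (map2 (\<lambda>b d. (base I b, d \<Gamma> (BaseT b) \<rho>)) (funArgs S f) (map (tmD S I) Ms))
      (tyD I \<sigma>) (\<lambda>xs. eta I (tyD I \<sigma>) (funD I f xs)))"
| "tmD S I (Cond L M N) = (\<lambda>\<Gamma> \<sigma> \<rho>.
    bindD I (base I (boolT S)) (tyD I \<sigma>) (tmD S I L \<Gamma> (BaseT (boolT S)) \<rho>)
      (\<lambda>x. if x = num I 1 then tmD S I M \<Gamma> \<sigma> \<rho> else tmD S I N \<Gamma> \<sigma> \<rho>))"
| "tmD S I (Op p Ns Ms) = (\<lambda>\<Gamma> \<sigma> \<rho>.
    bindsD I (map2 (\<lambda>b d. (base I b, d \<Gamma> (BaseT b) \<rho>)) (opPars S p) (map (tmD S I) Ns))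
      (tyD I \<sigma>) (\<lambda>xs. opD S I p (tyD I \<sigma>) xs (map (\<lambda>d. d \<Gamma> \<sigma> \<rho>) (map (tmD S I) Ms))))"
| "tmD S I Star = (\<lambda>\<Gamma> \<sigma> \<rho>. eta I (tyD I \<sigma>) (pt I))"
| "tmD S I (Pair M N) = (\<lambda>\<Gamma> \<upsilon> \<rho>. case \<upsilon> of
      ProdT \<sigma> \<tau> \<Rightarrow>
        bindD I (tyD I \<sigma>) (tyD I \<upsilon>) (tmD S I M \<Gamma> \<sigma> \<rho>) (\<lambda>x.
        bindD I (tyD I \<tau>) (tyD I \<upsilon>) (tmD S I N \<Gamma> \<tau> \<rho>) (\<lambda>y.
        eta I (tyD I \<upsilon>) (pair I x y)))
    | _ \<Rightarrow> undefined)"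
| "tmD S I (Fst M) = (\<lambda>\<Gamma> \<sigma> \<rho>.
    let \<tau> = (SOME \<tau>. typing S \<Gamma> M (ProdT \<sigma> \<tau>)) in
    bindD I (tyD I (ProdT \<sigma> \<tau>)) (tyD I \<sigma>) (tmD S I M \<Gamma> (ProdT \<sigma> \<tau>) \<rho>)
      (\<lambda>z. eta I (tyD I \<sigma>) (fstD I z)))"
| "tmD S I (Snd M) = (\<lambda>\<Gamma> \<tau> \<rho>.
    let \<sigma> = (SOME \<sigma>. typing S \<Gamma> M (ProdT \<sigma> \<tau>)) in
    bindD I (tyD I (ProdT \<sigma> \<tau>)) (tyD I \<tau>) (tmD S I M \<Gamma> (ProdT \<sigma> \<tau>) \<rho>)
      (\<lambda>z. eta I (tyD I \<tau>) (sndD I z)))"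
| "tmD S I (Lam \<sigma> M) = (\<lambda>\<Gamma> \<upsilon> \<rho>. case \<upsilon> of
      FunT _ \<tau> \<Rightarrow> eta I (tyD I \<upsilon>) (fn I (\<lambda>a \<in> tyD I \<sigma>. tmD S I M (\<sigma> # \<Gamma>) \<tau> (a # \<rho>)))
    | _ \<Rightarrow> undefined)"
| "tmD S I (App M N) = (\<lambda>\<Gamma> \<tau> \<rho>.
    let \<sigma> = (SOME \<sigma>. typing S \<Gamma> M (FunT \<sigma> \<tau>) \<and> typing S \<Gamma> N \<sigma>) in
    bindD I (tyD I (FunT \<sigma> \<tau>)) (tyD I \<tau>) (tmD S I M \<Gamma> (FunT \<sigma> \<tau>) \<rho>) (\<lambda>h.
    bindD I (tyD I \<sigma>) (tyD I \<tau>) (tmD S I N \<Gamma> \<sigma> \<rho>) (\<lambda>x.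
    appD I \<sigma> \<tau> h x)))"

definition envs :: "('b, 'c, 'f, 'o, 'u, 't) model \<Rightarrow> 'b ty list \<Rightarrow> 'u list set" where
  "envs I \<Gamma> = {\<rho>. list_all2 (\<lambda>x \<sigma>. x \<in> tyD I \<sigma>) \<rho> \<Gamma>}"

definition denotation ::
  "('b, 'c, 'f, 'o) signature \<Rightarrow> ('b, 'c, 'f, 'o, 'u, 't) model \<Rightarrow>
    'b ty list \<Rightarrow> ('b, 'c, 'f, 'o) tm \<Rightarrow> 'b ty \<Rightarrow> 'u list \<Rightarrow> 't" where
  "denotation S I \<Gamma> M \<sigma> = (\<lambda>\<rho> \<in> envs I \<Gamma>. tmD S I M \<Gamma> \<sigma> \<rho>)"

end

theory Submission
  imports Defs
begin

text \<open>
  Effect values exist by a reducibility argument: a program is reducible at a type if every branch of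
  its evaluation ends in a reducible value. They are unique because the decomposition of a program
  into an evaluation context and an active subterm is unique, and because truth and falsehood are
  different constants.

  Every evaluation context sequences its hole first, so it denotes \<open>t \<mapsto> k\<^sup>\<dagger>(t)\<close> for some \<open>k\<close>.
  Hence it preserves equalities of denotations, and associativity of Kleisli extension moves it inside
  an algebraic operation. The claim follows by induction on the evaluation.

  Terms do not have unique types, and the semantics of projections and applications chooses the type
  of a subterm. The choice is immaterial by a logical relation between the denotations of two types of
  a term, lifted along the monad by spans: computations are related if they are the two images of one
  computation of related pairs. At equal types the relation is equality.
\<close>

section \<open>Coherence of the semantics\<close>

text \<open>The types that \<open>tmD\<close> picks with \<open>SOME\<close> for the subterms of
  \<open>Fst\<close>, \<open>Snd\<close> and \<open>App\<close> may change under weakening or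
  substitution, so even these two lemmas for denotations rest on coherence. Coherence cannot be
  stated as an equality for the induction: the chosen types may differ, and then the denotations lie
  in different sets. An arbitrary monad acts on functions, not on relations; a span needs only
  \<open>T\<close> applied to the graph of the relation, a set of the model because
  \<open>pair\<close> codes pairs in the same type. Even an empty relation lifts usefully: the
  related computations are then images of one element of \<open>T\<close> of the empty set, which is
  how an operation of arity 0 behaves at unrelated types.

  \<open>effect_value\<close> is a \<open>THE\<close>, so nothing follows about it without both
  existence and uniqueness. Existence is syntactic except for one point: a conditional would be
  stuck on a third constant of type Bool. The model excludes it, since Bool denotes two elements and
  different constants of one type have different denotations.\<close>

inductive_cases typing_VarE: "typing S \<Gamma> (Var i) \<sigma>"
inductive_cases typing_ConstE: "typing S \<Gamma> (Const c) \<sigma>"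
inductive_cases typing_FAppE: "typing S \<Gamma> (FApp f Ms) \<sigma>"
inductive_cases typing_CondE: "typing S \<Gamma> (Cond L M N) \<sigma>"
inductive_cases typing_OpE: "typing S \<Gamma> (Op p Ns Ms) \<sigma>"
inductive_cases typing_StarE: "typing S \<Gamma> Star \<sigma>"
inductive_cases typing_PairE: "typing S \<Gamma> (Pair M N) \<sigma>"
inductive_cases typing_FstE: "typing S \<Gamma> (Fst M) \<sigma>"
inductive_cases typing_SndE: "typing S \<Gamma> (Snd M) \<sigma>"
inductive_cases typing_LamE: "typing S \<Gamma> (Lam \<sigma> M) \<tau>"
inductive_cases typing_AppE: "typing S \<Gamma> (App M N) \<sigma>"

text \<open>This is the Barr extension of the functor underlying the monad. The graph is coded with
  \<open>pair\<close> because \<open>T I\<close> applies only to sets of elements of the one carrier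
  type.\<close>

definition lifted ::
  "('b, 'c, 'f, 'o, 'u, 't) model \<Rightarrow> ('u \<Rightarrow> 'u \<Rightarrow> bool) \<Rightarrow> 'u set \<Rightarrow> 'u set \<Rightarrow> 't \<Rightarrow> 't \<Rightarrow> bool" where
  "lifted I R X Y t t' \<longleftrightarrow> (let G = {pair I x y | x y. R x y} in
    \<exists>u \<in> T I G. t = ext I G X (\<lambda>z. eta I X (fstD I z)) u \<and>
      t' = ext I G Y (\<lambda>z. eta I Y (sndD I z)) u)"

text \<open>Function types are related only if their argument types are equal. This suffices because lambda
  abstractions carry the type of their argument.\<close>

primrec tyR ::
  "('b, 'c, 'f, 'o, 'u, 't) model \<Rightarrow> 'b ty \<Rightarrow> 'b ty \<Rightarrow> 'u \<Rightarrow> 'u \<Rightarrow> bool" where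
  "tyR I (BaseT b) \<sigma>' x y \<longleftrightarrow> \<sigma>' = BaseT b \<and> x \<in> base I b \<and> x = y"
| "tyR I UnitT \<sigma>' x y \<longleftrightarrow> \<sigma>' = UnitT \<and> x = pt I \<and> y = pt I"
| "tyR I (ProdT \<sigma> \<tau>) \<upsilon> x y \<longleftrightarrow> (\<exists>\<sigma>' \<tau>' a b c d. \<upsilon> = ProdT \<sigma>' \<tau>' \<and> x = pair I a b \<and> y = pair I c d \<and>
    tyR I \<sigma> \<sigma>' a c \<and> tyR I \<tau> \<tau>' b d)"
| "tyR I (FunT \<sigma> \<tau>) \<upsilon> x y \<longleftrightarrow> (\<exists>\<tau>'. \<upsilon> = FunT \<sigma> \<tau>' \<and>
    x \<in> tyD I (FunT \<sigma> \<tau>) \<and> y \<in> tyD I (FunT \<sigma> \<tau>') \<and>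
    (\<forall>a \<in> tyD I \<sigma>. lifted I (tyR I \<tau> \<tau>') (tyD I \<tau>) (tyD I \<tau>')
      (appD I \<sigma> \<tau> x a) (appD I \<sigma> \<tau>' y a)))"

abbreviation related ::
  "('b, 'c, 'f, 'o, 'u, 't) model \<Rightarrow> 'b ty \<Rightarrow> 'b ty \<Rightarrow> 't \<Rightarrow> 't \<Rightarrow> bool" where
  "related I \<sigma> \<sigma>' \<equiv> lifted I (tyR I \<sigma> \<sigma>') (tyD I \<sigma>) (tyD I \<sigma>')"

section \<open>Codings, and the monad laws in terms of sequencing\<close>

context set_model
begin

lemma fstD_pair [simp]: "fstD I (pair I x y) = x"
  using inv_f_f[OF pair_inj, of "(x, y)"] by (simp add: fstD_def)

lemma sndD_pair [simp]: "sndD I (pair I x y) = y"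
  using inv_f_f[OF pair_inj, of "(x, y)"] by (simp add: sndD_def)

lemma pair_eq_iff [simp]: "pair I x y = pair I x' y' \<longleftrightarrow> x = x' \<and> y = y'"
  by (metis fstD_pair sndD_pair)

lemma inv_num [simp]: "inv (num I) (num I n) = n"
  by (rule inv_f_f[OF num_inj])

lemma appD_fn:
  "f \<in> tyD I \<sigma> \<rightarrow>\<^sub>E T I (tyD I \<tau>) \<Longrightarrow> appD I \<sigma> \<tau> (fn I f) = f"
  unfolding appD_def by (rule the_inv_into_f_f[OF fn_inj])

lemma fn_appD: "h \<in> tyD I (FunT \<sigma> \<tau>) \<Longrightarrow> fn I (appD I \<sigma> \<tau> h) = h"
  by (auto simp: appD_fn)

lemma appD_in: "h \<in> tyD I (FunT \<sigma> \<tau>) \<Longrightarrow> appD I \<sigma> \<tau> h \<in> tyD I \<sigma> \<rightarrow>\<^sub>E T I (tyD I \<tau>)"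
  by (auto simp: appD_fn simp del: PiE_iff)

lemma appD_closed: "h \<in> tyD I (FunT \<sigma> \<tau>) \<Longrightarrow> x \<in> tyD I \<sigma> \<Longrightarrow> appD I \<sigma> \<tau> h x \<in> T I (tyD I \<tau>)"
  using appD_in by (fastforce simp: PiE_iff)

lemma bindD_closed:
  "t \<in> T I X \<Longrightarrow> (\<And>x. x \<in> X \<Longrightarrow> k x \<in> T I Y) \<Longrightarrow> bindD I X Y t k \<in> T I Y"
  unfolding bindD_def by (rule ext_closed) auto

lemma bindD_cong:
  "t \<in> T I X \<Longrightarrow> (\<And>x. x \<in> X \<Longrightarrow> k x \<in> T I Y) \<Longrightarrow> (\<And>x. x \<in> X \<Longrightarrow> k x = k' x) \<Longrightarrow>
    bindD I X Y t k = bindD I X Y t k'"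
  unfolding bindD_def by (rule ext_cong) auto

lemma bindD_eta:
  "x \<in> X \<Longrightarrow> (\<And>x. x \<in> X \<Longrightarrow> k x \<in> T I Y) \<Longrightarrow> bindD I X Y (eta I X x) k = k x"
  unfolding bindD_def by (rule eta_ext) auto

lemma bindD_eta_right: "t \<in> T I X \<Longrightarrow> bindD I X X t (eta I X) = t"
  unfolding bindD_def by (rule ext_eta)

lemma bindD_assoc:
  "t \<in> T I X \<Longrightarrow> (\<And>x. x \<in> X \<Longrightarrow> k x \<in> T I Y) \<Longrightarrow> (\<And>y. y \<in> Y \<Longrightarrow> l y \<in> T I Z) \<Longrightarrow>
    bindD I Y Z (bindD I X Y t k) l = bindD I X Z t (\<lambda>x. bindD I Y Z (k x) l)"
  unfolding bindD_def by (rule ext_ext) auto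

text \<open>The inner computation is the action of the functor on \<open>f\<close>. The two images
  of a span have this form.\<close>

lemma bindD_eta_assoc:
  assumes "t \<in> T I X" "\<And>x. x \<in> X \<Longrightarrow> f x \<in> Y" "\<And>y. y \<in> Y \<Longrightarrow> k y \<in> T I Z"
  shows "bindD I Y Z (bindD I X Y t (\<lambda>x. eta I Y (f x))) k = bindD I X Z t (\<lambda>x. k (f x))"
proof -
  have "bindD I Y Z (bindD I X Y t (\<lambda>x. eta I Y (f x))) k =
      bindD I X Z t (\<lambda>x. bindD I Y Z (eta I Y (f x)) k)"
    using assms by (intro bindD_assoc) (simp_all add: eta_closed)
  also have "\<dots> = bindD I X Z t (\<lambda>x. k (f x))"
    using assms by (intro bindD_cong) (simp_all add: bindD_eta)
  finally show ?thesis .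
qed

section \<open>Lifting relations along the monad\<close>

lemma lifted_iff:
  "lifted I R X Y t t' \<longleftrightarrow> (\<exists>u \<in> T I {pair I x y | x y. R x y}.
    t = bindD I {pair I x y | x y. R x y} X u (\<lambda>z. eta I X (fstD I z)) \<and>
    t' = bindD I {pair I x y | x y. R x y} Y u (\<lambda>z. eta I Y (sndD I z)))"
  by (simp add: lifted_def bindD_def Let_def)

lemma lifted_eta:
  assumes "R x y" "\<And>x y. R x y \<Longrightarrow> x \<in> X \<and> y \<in> Y"
  shows "lifted I R X Y (eta I X x) (eta I Y y)"
  unfolding lifted_iff
proof (intro bexI conjI)
  let ?G = "{pair I x y | x y. R x y}"
  show "eta I ?G (pair I x y) \<in> T I ?G"
    using assms by (intro eta_closed) auto
  show "eta I X x = bindD I ?G X (eta I ?G (pair I x y)) (\<lambda>z. eta I X (fstD I z))"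
    using assms by (subst bindD_eta) (auto intro!: eta_closed)
  show "eta I Y y = bindD I ?G Y (eta I ?G (pair I x y)) (\<lambda>z. eta I Y (sndD I z))"
    using assms by (subst bindD_eta) (auto intro!: eta_closed)
qed

text \<open>The witness is the image of \<open>t\<close> under the diagonal, which sends
  \<open>x\<close> to the coded pair of \<open>x\<close> and \<open>x\<close>.\<close>

lemma lifted_refl:
  assumes t: "t \<in> T I X" and R: "\<And>x. x \<in> X \<Longrightarrow> R x x" "\<And>x y. R x y \<Longrightarrow> x \<in> X \<and> y \<in> X"
  shows "lifted I R X X t t"
  unfolding lifted_iff
proof (intro bexI conjI)
  let ?G = "{pair I x y | x y. R x y}"
  let ?u = "bindD I X ?G t (\<lambda>x. eta I ?G (pair I x x))"
  have *: "pair I x x \<in> ?G" if "x \<in> X" for x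
    using R that by blast
  show "?u \<in> T I ?G"
    using t by (rule bindD_closed) (rule eta_closed[OF *])
  have X: "fstD I z \<in> X" "sndD I z \<in> X" if "z \<in> ?G" for z
    using that R(2) by auto
  show "t = bindD I ?G X ?u (\<lambda>z. eta I X (fstD I z))"
    by (subst bindD_eta_assoc[OF t *]) (simp_all only: X eta_closed fstD_pair bindD_eta_right t)
  show "t = bindD I ?G X ?u (\<lambda>z. eta I X (sndD I z))"
    by (subst bindD_eta_assoc[OF t *]) (simp_all only: X eta_closed sndD_pair bindD_eta_right t)
qed

text \<open>The witnesses for the continuations form a family indexed by the graph of
  \<open>R\<close>; sequencing it after the witness \<open>u\<close> gives a witness for the result.
  Associativity carries both projections through.\<close>

lemma lifted_bind:
  assumes t: "lifted I R X X' t t'"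
    and R: "\<And>x y. R x y \<Longrightarrow> x \<in> X \<and> y \<in> X'" and Q: "\<And>x y. Q x y \<Longrightarrow> x \<in> Y \<and> y \<in> Y'"
    and k: "\<And>x. x \<in> X \<Longrightarrow> k x \<in> T I Y" and k': "\<And>x. x \<in> X' \<Longrightarrow> k' x \<in> T I Y'"
    and kk': "\<And>x x'. R x x' \<Longrightarrow> lifted I Q Y Y' (k x) (k' x')"
  shows "lifted I Q Y Y' (bindD I X Y t k) (bindD I X' Y' t' k')"
proof -
  let ?G = "{pair I x y | x y. R x y}" and ?H = "{pair I x y | x y. Q x y}"
  obtain u where u: "u \<in> T I ?G" "t = bindD I ?G X u (\<lambda>z. eta I X (fstD I z))"
      "t' = bindD I ?G X' u (\<lambda>z. eta I X' (sndD I z))"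
    using t unfolding lifted_iff by blast
  have "\<forall>z \<in> ?G. \<exists>w. w \<in> T I ?H \<and> k (fstD I z) = bindD I ?H Y w (\<lambda>z. eta I Y (fstD I z)) \<and>
      k' (sndD I z) = bindD I ?H Y' w (\<lambda>z. eta I Y' (sndD I z))"
  proof
    fix z assume "z \<in> ?G"
    then obtain x x' where "z = pair I x x'" "R x x'" by blast
    then show "\<exists>w. w \<in> T I ?H \<and> k (fstD I z) = bindD I ?H Y w (\<lambda>z. eta I Y (fstD I z)) \<and>
        k' (sndD I z) = bindD I ?H Y' w (\<lambda>z. eta I Y' (sndD I z))"
      using kk'[of x x'] unfolding lifted_iff Bex_def by simp
  qed
  \<comment> \<open>Choice is needed: each related pair has some witness of its own, while
    sequencing needs one function.\<close>
  from bchoice[OF this] obtain w where w: "\<And>z. z \<in> ?G \<Longrightarrow> w z \<in> T I ?H"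
      "\<And>z. z \<in> ?G \<Longrightarrow> k (fstD I z) = bindD I ?H Y (w z) (\<lambda>z. eta I Y (fstD I z))"
      "\<And>z. z \<in> ?G \<Longrightarrow> k' (sndD I z) = bindD I ?H Y' (w z) (\<lambda>z. eta I Y' (sndD I z))"
    by blast
  have G: "\<And>z. z \<in> ?G \<Longrightarrow> fstD I z \<in> X" "\<And>z. z \<in> ?G \<Longrightarrow> sndD I z \<in> X'"
    using R by auto
  have H: "\<And>z. z \<in> ?H \<Longrightarrow> fstD I z \<in> Y" "\<And>z. z \<in> ?H \<Longrightarrow> sndD I z \<in> Y'"
    using Q by auto
  show ?thesis
    unfolding lifted_iff
  proof (intro bexI conjI)
    show "bindD I ?G ?H u w \<in> T I ?H"
      by (rule bindD_closed[OF u(1) w(1)])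
    have "bindD I X Y t k = bindD I ?G Y u (\<lambda>z. k (fstD I z))"
      unfolding u(2) by (rule bindD_eta_assoc[OF u(1) G(1) k])
    also have "\<dots> = bindD I ?G Y u (\<lambda>z. bindD I ?H Y (w z) (\<lambda>z. eta I Y (fstD I z)))"
      by (rule bindD_cong[OF u(1) k[OF G(1)] w(2)])
    also have "\<dots> = bindD I ?H Y (bindD I ?G ?H u w) (\<lambda>z. eta I Y (fstD I z))"
      by (rule bindD_assoc[symmetric, OF u(1) w(1) eta_closed[OF H(1)]])
    finally show "bindD I X Y t k = bindD I ?H Y (bindD I ?G ?H u w) (\<lambda>z. eta I Y (fstD I z))" .
    have "bindD I X' Y' t' k' = bindD I ?G Y' u (\<lambda>z. k' (sndD I z))"
      unfolding u(3) by (rule bindD_eta_assoc[OF u(1) G(2) k'])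
    also have "\<dots> = bindD I ?G Y' u (\<lambda>z. bindD I ?H Y' (w z) (\<lambda>z. eta I Y' (sndD I z)))"
      by (rule bindD_cong[OF u(1) k'[OF G(2)] w(3)])
    also have "\<dots> = bindD I ?H Y' (bindD I ?G ?H u w) (\<lambda>z. eta I Y' (sndD I z))"
      by (rule bindD_assoc[symmetric, OF u(1) w(1) eta_closed[OF H(2)]])
    finally show "bindD I X' Y' t' k' = bindD I ?H Y' (bindD I ?G ?H u w) (\<lambda>z. eta I Y' (sndD I z))" .
  qed
qed

text \<open>On a graph inside the diagonal the two projections are the same function, so the two
  images coincide.\<close>

lemma lifted_eq:
  assumes "lifted I R X X t t'" "\<And>x y. R x y \<Longrightarrow> x = y" "\<And>x y. R x y \<Longrightarrow> x \<in> X \<and> y \<in> X"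
  shows "t = t'"
proof -
  let ?G = "{pair I x y | x y. R x y}"
  have G: "fstD I z \<in> X" "sndD I z = fstD I z" if "z \<in> ?G" for z
    using that assms(2,3) by fastforce+
  obtain u where u: "u \<in> T I ?G" "t = bindD I ?G X u (\<lambda>z. eta I X (fstD I z))"
      "t' = bindD I ?G X u (\<lambda>z. eta I X (sndD I z))"
    using assms(1) unfolding lifted_iff by blast
  show ?thesis
    unfolding u(2,3) by (rule bindD_cong[OF u(1)]) (simp_all add: G eta_closed del: mem_Collect_eq)
qed

section \<open>The logical relation between two types\<close>

lemma tyR_closed: "tyR I \<sigma> \<sigma>' x y \<Longrightarrow> x \<in> tyD I \<sigma> \<and> y \<in> tyD I \<sigma>'"
proof (induction \<sigma> arbitrary: \<sigma>' x y)
  case (ProdT \<sigma> \<tau>)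
  from ProdT.prems obtain \<sigma>1 \<tau>1 a b c d where *: "\<sigma>' = ProdT \<sigma>1 \<tau>1" "x = pair I a b" "y = pair I c d"
      "tyR I \<sigma> \<sigma>1 a c" "tyR I \<tau> \<tau>1 b d"
    by auto
  from ProdT.IH(1)[OF *(4)] ProdT.IH(2)[OF *(5)] * show ?case by simp
next
  case (FunT \<sigma> \<tau>)
  then show ?case by (auto simp del: tyD.simps)
qed simp_all

text \<open>At function types, \<open>lifted_eq\<close> turns the pointwise lifted relation into
  pointwise equality, and a code is determined by the function that it decodes to.\<close>

lemma tyR_eq: "tyR I \<sigma> \<sigma> x y \<Longrightarrow> x = y"
proof (induction \<sigma> arbitrary: x y)
  case (FunT \<sigma> \<tau>)
  then have xy: "x \<in> tyD I (FunT \<sigma> \<tau>)" "y \<in> tyD I (FunT \<sigma> \<tau>)"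
    and *: "\<And>a. a \<in> tyD I \<sigma> \<Longrightarrow> related I \<tau> \<tau> (appD I \<sigma> \<tau> x a) (appD I \<sigma> \<tau> y a)"
    by auto
  have "appD I \<sigma> \<tau> x = appD I \<sigma> \<tau> y"
    by (rule PiE_ext[OF appD_in[OF xy(1)] appD_in[OF xy(2)]])
      (erule lifted_eq[OF *]; simp only: FunT.IH tyR_closed)
  then show ?case using fn_appD xy by metis
next
  case (ProdT \<sigma> \<tau>)
  then show ?case by auto
qed simp_all

lemma tyR_refl: "x \<in> tyD I \<sigma> \<Longrightarrow> tyR I \<sigma> \<sigma> x x"
proof (induction \<sigma> arbitrary: x)
  case (FunT \<sigma> \<tau>)
  have "related I \<tau> \<tau> (appD I \<sigma> \<tau> x a) (appD I \<sigma> \<tau> x a)" if "a \<in> tyD I \<sigma>" for a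
    using appD_closed[OF FunT.prems that] by (rule lifted_refl) (simp_all only: FunT.IH tyR_closed)
  then show ?case using FunT.prems by simp
next
  case (ProdT \<sigma> \<tau>)
  then obtain a b where "x = pair I a b" "a \<in> tyD I \<sigma>" "b \<in> tyD I \<tau>" by auto
  with ProdT.IH show ?case unfolding tyR.simps by blast
qed simp_all

lemma related_refl: "t \<in> T I (tyD I \<sigma>) \<Longrightarrow> related I \<sigma> \<sigma> t t"
  by (erule lifted_refl) (simp_all only: tyR_refl tyR_closed)

lemma related_eq: "related I \<sigma> \<sigma> t t' \<Longrightarrow> t = t'"
  by (erule lifted_eq) (simp_all only: tyR_eq tyR_closed)

lemma related_bind_same:
  assumes "t \<in> T I X" "\<And>x. x \<in> X \<Longrightarrow> k x \<in> T I (tyD I \<tau>)" "\<And>x. x \<in> X \<Longrightarrow> k' x \<in> T I (tyD I \<tau>')"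
    and "\<And>x. x \<in> X \<Longrightarrow> related I \<tau> \<tau>' (k x) (k' x)"
  shows "related I \<tau> \<tau>' (bindD I X (tyD I \<tau>) t k) (bindD I X (tyD I \<tau>') t k')"
  \<comment> \<open>The identity relation on \<open>X\<close> makes the shared first computation a
    related pair.\<close>
  by (rule lifted_bind[OF lifted_refl[OF assms(1), of "\<lambda>x y. x \<in> X \<and> x = y"]])
    (use assms tyR_closed in auto)

lemma related_fst:
  assumes "related I (ProdT \<sigma> \<tau>) (ProdT \<sigma>' \<tau>') t t'"
  shows "related I \<sigma> \<sigma>'
    (bindD I (tyD I (ProdT \<sigma> \<tau>)) (tyD I \<sigma>) t (\<lambda>z. eta I (tyD I \<sigma>) (fstD I z)))
    (bindD I (tyD I (ProdT \<sigma>' \<tau>')) (tyD I \<sigma>') t' (\<lambda>z. eta I (tyD I \<sigma>') (fstD I z)))"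
proof (rule lifted_bind[OF assms])
qed (use tyR_closed in \<open>auto intro!: eta_closed lifted_eta\<close>)

lemma related_snd:
  assumes "related I (ProdT \<sigma> \<tau>) (ProdT \<sigma>' \<tau>') t t'"
  shows "related I \<tau> \<tau>'
    (bindD I (tyD I (ProdT \<sigma> \<tau>)) (tyD I \<tau>) t (\<lambda>z. eta I (tyD I \<tau>) (sndD I z)))
    (bindD I (tyD I (ProdT \<sigma>' \<tau>')) (tyD I \<tau>') t' (\<lambda>z. eta I (tyD I \<tau>') (sndD I z)))"
proof (rule lifted_bind[OF assms])
qed (use tyR_closed in \<open>auto intro!: eta_closed lifted_eta\<close>)

lemma related_app:
  assumes t: "related I (FunT \<sigma> \<tau>) (FunT \<sigma>' \<tau>') t t'" and u: "related I \<sigma> \<sigma>' u u'"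
    and closed: "u \<in> T I (tyD I \<sigma>)" "u' \<in> T I (tyD I \<sigma>')"
  shows "related I \<tau> \<tau>'
    (bindD I (tyD I (FunT \<sigma> \<tau>)) (tyD I \<tau>) t (\<lambda>h.
      bindD I (tyD I \<sigma>) (tyD I \<tau>) u (appD I \<sigma> \<tau> h)))
    (bindD I (tyD I (FunT \<sigma>' \<tau>')) (tyD I \<tau>') t' (\<lambda>h.
      bindD I (tyD I \<sigma>') (tyD I \<tau>') u' (appD I \<sigma>' \<tau>' h)))"
proof (rule lifted_bind[OF t])
  fix h h' assume h: "tyR I (FunT \<sigma> \<tau>) (FunT \<sigma>' \<tau>') h h'"
  show "related I \<tau> \<tau>' (bindD I (tyD I \<sigma>) (tyD I \<tau>) u (appD I \<sigma> \<tau> h))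
     (bindD I (tyD I \<sigma>') (tyD I \<tau>') u' (appD I \<sigma>' \<tau>' h'))"
  proof (rule lifted_bind[OF u])
    fix x x' assume "tyR I \<sigma> \<sigma>' x x'"
    then show "related I \<tau> \<tau>' (appD I \<sigma> \<tau> h x) (appD I \<sigma>' \<tau>' h' x')"
      \<comment> \<open>\<open>h\<close> forces equal argument types, so \<open>x\<close> and
        \<open>x'\<close> are equal and the relation on functions, which tests equal arguments only,
        applies.\<close>
      using h tyR_eq tyR_closed by fastforce
  qed (use tyR_closed[OF h] tyR_closed appD_closed in auto)
qed (use closed tyR_closed in \<open>auto intro!: bindD_closed appD_closed simp del: tyD.simps tyR.simps\<close>)

end

section \<open>Argument lists and algebraic operations\<close>

definition argsD ::
  "('b, 'c, 'f, 'o) signature \<Rightarrow> ('b, 'c, 'f, 'o, 'u, 't) model \<Rightarrow> 'b list \<Rightarrow>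
    ('b, 'c, 'f, 'o) tm list \<Rightarrow> 'b ty list \<Rightarrow> 'u list \<Rightarrow> ('u set \<times> 't) list" where
  "argsD S I bs Ms \<Gamma> \<rho> = map2 (\<lambda>b M. (base I b, tmD S I M \<Gamma> (BaseT b) \<rho>)) bs Ms"

lemma argsD_Cons [simp]:
  "argsD S I (b # bs) (M # Ms) \<Gamma> \<rho> = (base I b, tmD S I M \<Gamma> (BaseT b) \<rho>) # argsD S I bs Ms \<Gamma> \<rho>"
  by (simp add: argsD_def)

lemma argsD_Nil [simp]: "argsD S I [] [] \<Gamma> \<rho> = []"
  by (simp add: argsD_def)

text \<open>Primitive recursion makes \<open>tmD\<close> work on a list of mapped denotations;
  \<open>argsD\<close> ranges over the terms themselves, which suits inductions on argument
  lists.\<close>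

lemma tmD_FApp: "tmD S I (FApp f Ms) \<Gamma> \<sigma> \<rho> =
    bindsD I (argsD S I (funArgs S f) Ms \<Gamma> \<rho>) (tyD I \<sigma>) (\<lambda>xs. eta I (tyD I \<sigma>) (funD I f xs))"
  by (simp add: argsD_def zip_map2 case_prod_unfold comp_def)

lemma tmD_Op: "tmD S I (Op p Ns Ms) \<Gamma> \<sigma> \<rho> =
    bindsD I (argsD S I (opPars S p) Ns \<Gamma> \<rho>) (tyD I \<sigma>)
      (\<lambda>xs. opD S I p (tyD I \<sigma>) xs (map (\<lambda>M. tmD S I M \<Gamma> \<sigma> \<rho>) Ms))"
  by (simp add: argsD_def zip_map2 case_prod_unfold comp_def)

lemma list_all2_typing_mono:
  "list_all2 (\<lambda>M b. typing S \<Gamma> M (g b)) Ms bs \<Longrightarrow> (\<And>M b. M \<in> set Ms \<Longrightarrow> typing S \<Gamma> M (g b) \<Longrightarrow> P M b) \<Longrightarrow>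
    list_all2 P Ms bs"
  by (induction rule: list_all2_induct) auto

context set_model
begin

lemma bindsD_closed:
  "\<forall>(X, t) \<in> set Xts. t \<in> T I X \<Longrightarrow>
    (\<And>xs. list_all2 (\<lambda>x Xt. x \<in> fst Xt) xs Xts \<Longrightarrow> k xs \<in> T I Y) \<Longrightarrow> bindsD I Xts Y k \<in> T I Y"
proof (induction Xts arbitrary: k)
  case (Cons Xt Xts)
  then show ?case by (cases Xt) (auto intro!: bindD_closed Cons.IH)
qed simp

text \<open>The signature fixes the types of parameters, so both sides sequence the same
  computations and differ only in the continuation.\<close>

lemma bindsD_related:
  "\<forall>(X, t) \<in> set Xts. t \<in> T I X \<Longrightarrow>
    (\<And>xs. list_all2 (\<lambda>x Xt. x \<in> fst Xt) xs Xts \<Longrightarrow>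
      k xs \<in> T I (tyD I \<sigma>) \<and> k' xs \<in> T I (tyD I \<sigma>') \<and> related I \<sigma> \<sigma>' (k xs) (k' xs)) \<Longrightarrow>
    related I \<sigma> \<sigma>' (bindsD I Xts (tyD I \<sigma>) k) (bindsD I Xts (tyD I \<sigma>') k')"
proof (induction Xts arbitrary: k k')
  case (Cons Xt Xts)
  then show ?case
    by (cases Xt) (auto intro!: related_bind_same bindsD_closed Cons.IH)
qed simp

lemma argsD_elems:
  "list_all2 (\<lambda>M b. tmD S I M \<Gamma> (BaseT b) \<rho> \<in> T I (base I b)) Ms bs \<Longrightarrow>
    \<forall>(X, t) \<in> set (argsD S I bs Ms \<Gamma> \<rho>). t \<in> T I X"
  by (induction rule: list_all2_induct) auto

lemma argsD_typed:
  "length Ms = length bs \<Longrightarrow>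
    list_all2 (\<lambda>x Xt. x \<in> fst Xt) xs (argsD S I bs Ms \<Gamma> \<rho>) \<longleftrightarrow> list_all2 (\<lambda>x b. x \<in> base I b) xs bs"
  by (induction bs arbitrary: Ms xs) (auto simp: list_all2_Cons2 length_Suc_conv)

lemma bindsD_args_closed:
  assumes "list_all2 (\<lambda>M b. tmD S I M \<Gamma> (BaseT b) \<rho> \<in> T I (base I b)) Ms bs"
    and "\<And>xs. list_all2 (\<lambda>x b. x \<in> base I b) xs bs \<Longrightarrow> k xs \<in> T I Y"
  shows "bindsD I (argsD S I bs Ms \<Gamma> \<rho>) Y k \<in> T I Y"
  using assms argsD_elems[OF assms(1)]
  by (intro bindsD_closed) (auto simp: argsD_typed list_all2_lengthD)

lemma bindsD_args_related:
  assumes "list_all2 (\<lambda>M b. tmD S I M \<Gamma> (BaseT b) \<rho> \<in> T I (base I b)) Ms bs"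
    and "\<And>xs. list_all2 (\<lambda>x b. x \<in> base I b) xs bs \<Longrightarrow>
      k xs \<in> T I (tyD I \<sigma>) \<and> k' xs \<in> T I (tyD I \<sigma>') \<and> related I \<sigma> \<sigma>' (k xs) (k' xs)"
  shows "related I \<sigma> \<sigma>' (bindsD I (argsD S I bs Ms \<Gamma> \<rho>) (tyD I \<sigma>) k)
    (bindsD I (argsD S I bs Ms \<Gamma> \<rho>) (tyD I \<sigma>') k')"
  using assms argsD_elems[OF assms(1)]
  by (intro bindsD_related) (auto simp: argsD_typed list_all2_lengthD)

lemma opD_closed:
  assumes "list_all2 (\<lambda>x b. x \<in> base I b) xs (opPars S p)"
    and "length us = opArity S p" "\<forall>u \<in> set us. u \<in> T I X"
  shows "opD S I p X xs us \<in> T I X"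
  unfolding opD_def using assms
  by (intro ext_closed gen_closed) (auto simp: numerals_below_def)

text \<open>The generic effect is one computation for both result types; only the branches selected
  by its index differ.\<close>

lemma opD_related:
  assumes "list_all2 (\<lambda>x b. x \<in> base I b) xs (opPars S p)"
    and "length us = opArity S p" "\<forall>u \<in> set us. u \<in> T I (tyD I \<sigma>)" "\<forall>u \<in> set us'. u \<in> T I (tyD I \<sigma>')"
    and "list_all2 (related I \<sigma> \<sigma>') us us'"
  shows "related I \<sigma> \<sigma>' (opD S I p (tyD I \<sigma>) xs us) (opD S I p (tyD I \<sigma>') xs us')"
  unfolding opD_def bindD_def[symmetric]
  using assms gen_closed[OF assms(1)]
  by (intro related_bind_same) (auto simp: numerals_below_def list_all2_conv_all_nth)

text \<open>Algebraicity: the operation is itself a Kleisli extension along the generic effect, so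
  associativity lets a continuation pass into the arguments.\<close>

lemma opD_bind:
  assumes "list_all2 (\<lambda>x b. x \<in> base I b) xs (opPars S p)"
    and "length us = opArity S p" "\<forall>u \<in> set us. u \<in> T I X" "\<And>x. x \<in> X \<Longrightarrow> k x \<in> T I Y"
  shows "bindD I X Y (opD S I p X xs us) k = opD S I p Y xs (map (\<lambda>u. bindD I X Y u k) us)"
proof -
  let ?N = "numerals_below I (opArity S p)"
  have us: "us ! inv (num I) i \<in> T I X" if "i \<in> ?N" for i
    using that assms(2,3) by (auto simp: numerals_below_def)
  have "bindD I X Y (opD S I p X xs us) k =
      bindD I ?N Y (gen I p xs) (\<lambda>i. bindD I X Y (us ! inv (num I) i) k)"
    unfolding opD_def bindD_def[of I ?N, symmetric]
    by (rule bindD_assoc[OF gen_closed[OF assms(1)] us assms(4)])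
  also have "\<dots> = opD S I p Y xs (map (\<lambda>u. bindD I X Y u k) us)"
    unfolding opD_def bindD_def[of I ?N, symmetric]
    by (rule bindD_cong[OF gen_closed[OF assms(1)] bindD_closed[OF us assms(4)]])
      (use assms(2) in \<open>auto simp: numerals_below_def\<close>)
  finally show ?thesis .
qed

section \<open>Denotations of typed terms and their independence of chosen types\<close>

lemma fstD_closed: "z \<in> tyD I (ProdT \<sigma> \<tau>) \<Longrightarrow> fstD I z \<in> tyD I \<sigma>"
  and sndD_closed: "z \<in> tyD I (ProdT \<sigma> \<tau>) \<Longrightarrow> sndD I z \<in> tyD I \<tau>"
  by auto

text \<open>The induction is on the term, not on the derivation: at projections and applications the
  chosen type need not occur in a given derivation, so the induction hypothesis is needed at every
  type.\<close>

lemma tmD_closed: "typing S \<Gamma> M \<sigma> \<Longrightarrow> \<rho> \<in> envs I \<Gamma> \<Longrightarrow> tmD S I M \<Gamma> \<sigma> \<rho> \<in> T I (tyD I \<sigma>)"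
proof (induction M arbitrary: \<Gamma> \<sigma> \<rho>)
  case (Var i)
  then show ?case
    by (auto elim!: typing_VarE intro!: eta_closed simp: envs_def list_all2_conv_all_nth)
next
  case (Const c)
  then show ?case by (auto elim!: typing_ConstE intro!: eta_closed const_closed)
next
  case (FApp f Ms)
  from FApp.prems(1) have \<sigma>: "\<sigma> = BaseT (funRes S f)"
    and Ms: "list_all2 (\<lambda>M b. typing S \<Gamma> M (BaseT b)) Ms (funArgs S f)"
    by (auto elim: typing_FAppE)
  have "list_all2 (\<lambda>M b. tmD S I M \<Gamma> (BaseT b) \<rho> \<in> T I (base I b)) Ms (funArgs S f)"
    by (rule list_all2_typing_mono[OF Ms]) (use FApp.IH FApp.prems(2) in fastforce)
  then show ?case
    unfolding tmD_FApp \<sigma> by (rule bindsD_args_closed) (simp add: eta_closed fun_closed)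
next
  case (Cond L M N)
  from Cond.prems(1) show ?case
    by (rule typing_CondE) (use Cond.prems(2) Cond.IH in \<open>auto intro!: bindD_closed\<close>, fastforce)
next
  case (Op p Ns Ms)
  from Op.prems(1) have Ns: "list_all2 (\<lambda>M b. typing S \<Gamma> M (BaseT b)) Ns (opPars S p)"
    and Ms: "length Ms = opArity S p" "\<forall>M \<in> set Ms. typing S \<Gamma> M \<sigma>"
    by (auto elim: typing_OpE)
  have "list_all2 (\<lambda>M b. tmD S I M \<Gamma> (BaseT b) \<rho> \<in> T I (base I b)) Ns (opPars S p)"
    by (rule list_all2_typing_mono[OF Ns]) (use Op.IH(1) Op.prems(2) in fastforce)
  then show ?case
    unfolding tmD_Op
    by (rule bindsD_args_closed) (rule opD_closed; use Ms Op.IH(2) Op.prems(2) in auto)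
next
  case Star
  then show ?case by (auto elim!: typing_StarE intro!: eta_closed)
next
  case (Pair M N)
  from Pair.prems(1) show ?case
    by (rule typing_PairE) (use Pair.prems(2) Pair.IH in \<open>auto intro!: bindD_closed eta_closed\<close>)
next
  case (Fst M)
  from Fst.prems(1) have "\<exists>\<tau>. typing S \<Gamma> M (ProdT \<sigma> \<tau>)"
    by (auto elim: typing_FstE)
  from someI_ex[OF this] Fst show ?case
    by (auto simp: Let_def simp del: tyD.simps intro!: bindD_closed eta_closed fstD_closed)
next
  case (Snd M)
  from Snd.prems(1) have "\<exists>\<tau>. typing S \<Gamma> M (ProdT \<tau> \<sigma>)"
    by (auto elim: typing_SndE)
  from someI_ex[OF this] Snd show ?case
    by (auto simp: Let_def simp del: tyD.simps intro!: bindD_closed eta_closed sndD_closed)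
next
  case (Lam \<tau> M)
  from Lam.prems(1) show ?case
    by (rule typing_LamE)
      (use Lam.prems(2) Lam.IH in \<open>auto intro!: eta_closed imageI simp: envs_def\<close>)
next
  case (App M N)
  from App.prems(1) have "\<exists>\<tau>. typing S \<Gamma> M (FunT \<tau> \<sigma>) \<and> typing S \<Gamma> N \<tau>"
    by (auto elim: typing_AppE)
  from someI_ex[OF this] App show ?case
    by (auto simp: Let_def simp del: tyD.simps intro!: bindD_closed appD_closed)
qed

lemma tmD_args_closed:
  "list_all2 (\<lambda>M b. typing S \<Gamma> M (BaseT b)) Ms bs \<Longrightarrow> \<rho> \<in> envs I \<Gamma> \<Longrightarrow>
    list_all2 (\<lambda>M b. tmD S I M \<Gamma> (BaseT b) \<rho> \<in> T I (base I b)) Ms bs"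
  by (erule list_all2_mono) (metis tmD_closed tyD.simps(1))

text \<open>One context and one environment serve both sides, since a lambda abstraction extends
  either context by its own annotation. Terms with a determined type are thus reflexive cases.
  Operations of arity 0 need no special treatment, as their list of branches is empty.\<close>

lemma tmD_coherent:
  "typing S \<Gamma> M \<sigma> \<Longrightarrow> typing S \<Gamma> M \<sigma>' \<Longrightarrow> \<rho> \<in> envs I \<Gamma> \<Longrightarrow>
    related I \<sigma> \<sigma>' (tmD S I M \<Gamma> \<sigma> \<rho>) (tmD S I M \<Gamma> \<sigma>' \<rho>)"
proof (induction M arbitrary: \<Gamma> \<sigma> \<sigma>' \<rho>)
  case (Var i)
  then have "\<sigma>' = \<sigma>" by (auto elim!: typing_VarE)
  with Var show ?case by (simp only: related_refl tmD_closed)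
next
  case (Const c)
  then have "\<sigma>' = \<sigma>" by (auto elim!: typing_ConstE)
  with Const show ?case by (simp only: related_refl tmD_closed)
next
  case (FApp f Ms)
  then have "\<sigma>' = \<sigma>" by (auto elim!: typing_FAppE)
  with FApp show ?case by (simp only: related_refl tmD_closed)
next
  case (Cond L M N)
  from Cond.prems have L: "typing S \<Gamma> L (BaseT (boolT S))"
    and M: "typing S \<Gamma> M \<sigma>" "typing S \<Gamma> M \<sigma>'" and N: "typing S \<Gamma> N \<sigma>" "typing S \<Gamma> N \<sigma>'"
    by (auto elim: typing_CondE)
  from tmD_closed[OF L Cond.prems(3)] show ?case
    by (simp only: tmD.simps tyD.simps, intro related_bind_same)
      (simp_all add: M N Cond.IH Cond.prems(3) tmD_closed)
next
  case (Op p Ns Ms)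
  from Op.prems have Ns: "list_all2 (\<lambda>M b. typing S \<Gamma> M (BaseT b)) Ns (opPars S p)"
    and Ms: "length Ms = opArity S p" "\<forall>M \<in> set Ms. typing S \<Gamma> M \<sigma>" "\<forall>M \<in> set Ms. typing S \<Gamma> M \<sigma>'"
    by (auto elim: typing_OpE)
  show ?case
    unfolding tmD_Op
  proof (rule bindsD_args_related[OF tmD_args_closed[OF Ns Op.prems(3)]], intro conjI)
    fix xs assume xs: "list_all2 (\<lambda>x b. x \<in> base I b) xs (opPars S p)"
    have rel: "list_all2 (related I \<sigma> \<sigma>') (map (\<lambda>M. tmD S I M \<Gamma> \<sigma> \<rho>) Ms) (map (\<lambda>M. tmD S I M \<Gamma> \<sigma>' \<rho>) Ms)"
      using Ms Op.IH(2) Op.prems(3) by (simp add: list_all2_conv_all_nth)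
    show "opD S I p (tyD I \<sigma>) xs (map (\<lambda>M. tmD S I M \<Gamma> \<sigma> \<rho>) Ms) \<in> T I (tyD I \<sigma>)"
      and "opD S I p (tyD I \<sigma>') xs (map (\<lambda>M. tmD S I M \<Gamma> \<sigma>' \<rho>) Ms) \<in> T I (tyD I \<sigma>')"
      using Ms tmD_closed Op.prems(3) by (auto intro!: opD_closed[OF xs])
    show "related I \<sigma> \<sigma>' (opD S I p (tyD I \<sigma>) xs (map (\<lambda>M. tmD S I M \<Gamma> \<sigma> \<rho>) Ms))
        (opD S I p (tyD I \<sigma>') xs (map (\<lambda>M. tmD S I M \<Gamma> \<sigma>' \<rho>) Ms))"
      by (rule opD_related[OF xs _ _ _ rel]) (use Ms tmD_closed Op.prems(3) in auto)
  qed
next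
  case Star
  then have "\<sigma>' = \<sigma>" by (auto elim!: typing_StarE)
  with Star show ?case by (simp only: related_refl tmD_closed)
next
  case (Pair M N)
  from Pair.prems obtain \<sigma>1 \<sigma>2 \<sigma>1' \<sigma>2' where \<sigma>: "\<sigma> = ProdT \<sigma>1 \<sigma>2" "\<sigma>' = ProdT \<sigma>1' \<sigma>2'"
    and M: "typing S \<Gamma> M \<sigma>1" "typing S \<Gamma> M \<sigma>1'" and N: "typing S \<Gamma> N \<sigma>2" "typing S \<Gamma> N \<sigma>2'"
    by (elim typing_PairE) blast
  have pair: "related I \<sigma> \<sigma>' (eta I (tyD I \<sigma>) (pair I x y)) (eta I (tyD I \<sigma>') (pair I x' y'))"
    if "tyR I \<sigma>1 \<sigma>1' x x'" "tyR I \<sigma>2 \<sigma>2' y y'" for x x' y y'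
    by (rule lifted_eta[OF _ tyR_closed]) (use that \<sigma> in auto)
  have closed: "eta I (tyD I \<sigma>) (pair I x y) \<in> T I (tyD I \<sigma>)" if "x \<in> tyD I \<sigma>1" "y \<in> tyD I \<sigma>2" for x y
    by (rule eta_closed) (use that \<sigma> in auto)
  have closed': "eta I (tyD I \<sigma>') (pair I x y) \<in> T I (tyD I \<sigma>')" if "x \<in> tyD I \<sigma>1'" "y \<in> tyD I \<sigma>2'" for x y
    by (rule eta_closed) (use that \<sigma> in auto)
  have "related I \<sigma> \<sigma>'
    (bindD I (tyD I \<sigma>1) (tyD I \<sigma>) (tmD S I M \<Gamma> \<sigma>1 \<rho>) (\<lambda>x.
      bindD I (tyD I \<sigma>2) (tyD I \<sigma>) (tmD S I N \<Gamma> \<sigma>2 \<rho>) (\<lambda>y. eta I (tyD I \<sigma>) (pair I x y))))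
    (bindD I (tyD I \<sigma>1') (tyD I \<sigma>') (tmD S I M \<Gamma> \<sigma>1' \<rho>) (\<lambda>x.
      bindD I (tyD I \<sigma>2') (tyD I \<sigma>') (tmD S I N \<Gamma> \<sigma>2' \<rho>) (\<lambda>y. eta I (tyD I \<sigma>') (pair I x y))))"
    by (rule lifted_bind[OF Pair.IH(1)[OF M Pair.prems(3)] tyR_closed tyR_closed], assumption, assumption)
      (auto intro!: bindD_closed tmD_closed N Pair.prems(3) closed closed' pair
        lifted_bind[OF Pair.IH(2)[OF N Pair.prems(3)] tyR_closed tyR_closed] dest: tyR_closed)
  then show ?case by (simp only: \<sigma> tmD.simps ty.case)
next
  case (Fst M)
  from Fst.prems have "\<exists>\<tau>. typing S \<Gamma> M (ProdT \<sigma> \<tau>)" "\<exists>\<tau>. typing S \<Gamma> M (ProdT \<sigma>' \<tau>)"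
    by (auto elim: typing_FstE)
  from related_fst[OF Fst.IH[OF this[THEN someI_ex] Fst.prems(3)]] show ?case
    by (simp add: Let_def del: tyD.simps)
next
  case (Snd M)
  from Snd.prems have "\<exists>\<tau>. typing S \<Gamma> M (ProdT \<tau> \<sigma>)" "\<exists>\<tau>. typing S \<Gamma> M (ProdT \<tau> \<sigma>')"
    by (auto elim: typing_SndE)
  from related_snd[OF Snd.IH[OF this[THEN someI_ex] Snd.prems(3)]] show ?case
    by (simp add: Let_def del: tyD.simps)
next
  case (Lam \<upsilon> M)
  from Lam.prems obtain \<tau> \<tau>' where \<sigma>: "\<sigma> = FunT \<upsilon> \<tau>" "\<sigma>' = FunT \<upsilon> \<tau>'"
    and M: "typing S (\<upsilon> # \<Gamma>) M \<tau>" "typing S (\<upsilon> # \<Gamma>) M \<tau>'"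
    by (auto elim!: typing_LamE)
  define h h' where "h = (\<lambda>a \<in> tyD I \<upsilon>. tmD S I M (\<upsilon> # \<Gamma>) \<tau> (a # \<rho>))"
    and "h' = (\<lambda>a \<in> tyD I \<upsilon>. tmD S I M (\<upsilon> # \<Gamma>) \<tau>' (a # \<rho>))"
  have env: "a # \<rho> \<in> envs I (\<upsilon> # \<Gamma>)" if "a \<in> tyD I \<upsilon>" for a
    using that Lam.prems(3) by (simp add: envs_def)
  have h: "h \<in> tyD I \<upsilon> \<rightarrow>\<^sub>E T I (tyD I \<tau>)" "h' \<in> tyD I \<upsilon> \<rightarrow>\<^sub>E T I (tyD I \<tau>')"
    unfolding h_def h'_def using tmD_closed M env by auto
  have "tyR I \<sigma> \<sigma>' (fn I h) (fn I h')"
    using h M Lam.IH env by (simp add: \<sigma> appD_fn) (simp add: h_def h'_def)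
  then show ?case
    using lifted_eta[of "tyR I \<sigma> \<sigma>'", OF _ tyR_closed] by (simp add: \<sigma> h_def h'_def del: tyR.simps tyD.simps)
next
  case (App M N)
  from App.prems have "\<exists>\<tau>. typing S \<Gamma> M (FunT \<tau> \<sigma>) \<and> typing S \<Gamma> N \<tau>"
      "\<exists>\<tau>. typing S \<Gamma> M (FunT \<tau> \<sigma>') \<and> typing S \<Gamma> N \<tau>"
    by (auto elim: typing_AppE)
  note * = this[THEN someI_ex]
  from related_app[OF App.IH(1) App.IH(2) tmD_closed tmD_closed,
      OF *[THEN conjunct1] App.prems(3) *[THEN conjunct2] App.prems(3)
        *(1)[THEN conjunct2] App.prems(3) *(2)[THEN conjunct2] App.prems(3)]
  show ?case
    by (simp add: Let_def del: tyD.simps)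
qed

text \<open>At equal result types coherence is equality, so the chosen type may be replaced by that
  of any derivation. With this and its two companions, later inductions can follow typing
  derivations.\<close>

lemma tmD_Fst:
  assumes "typing S \<Gamma> M (ProdT \<sigma> \<tau>)" "\<rho> \<in> envs I \<Gamma>"
  shows "tmD S I (Fst M) \<Gamma> \<sigma> \<rho> = bindD I (tyD I (ProdT \<sigma> \<tau>)) (tyD I \<sigma>)
    (tmD S I M \<Gamma> (ProdT \<sigma> \<tau>) \<rho>) (\<lambda>z. eta I (tyD I \<sigma>) (fstD I z))"
  unfolding tmD.simps Let_def
  by (rule related_eq[OF related_fst[OF tmD_coherent]])
    (use someI[of "\<lambda>\<tau>. typing S \<Gamma> M (ProdT \<sigma> \<tau>)", OF assms(1)] assms in simp_all)

lemma tmD_Snd: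
  assumes "typing S \<Gamma> M (ProdT \<sigma> \<tau>)" "\<rho> \<in> envs I \<Gamma>"
  shows "tmD S I (Snd M) \<Gamma> \<tau> \<rho> = bindD I (tyD I (ProdT \<sigma> \<tau>)) (tyD I \<tau>)
    (tmD S I M \<Gamma> (ProdT \<sigma> \<tau>) \<rho>) (\<lambda>z. eta I (tyD I \<tau>) (sndD I z))"
  unfolding tmD.simps Let_def
  by (rule related_eq[OF related_snd[OF tmD_coherent]])
    (use someI[of "\<lambda>\<sigma>. typing S \<Gamma> M (ProdT \<sigma> \<tau>)", OF assms(1)] assms in simp_all)

lemma tmD_App:
  assumes "typing S \<Gamma> M (FunT \<sigma> \<tau>)" "typing S \<Gamma> N \<sigma>" "\<rho> \<in> envs I \<Gamma>"
  shows "tmD S I (App M N) \<Gamma> \<tau> \<rho> = bindD I (tyD I (FunT \<sigma> \<tau>)) (tyD I \<tau>)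
    (tmD S I M \<Gamma> (FunT \<sigma> \<tau>) \<rho>) (\<lambda>h. bindD I (tyD I \<sigma>) (tyD I \<tau>) (tmD S I N \<Gamma> \<sigma> \<rho>) (appD I \<sigma> \<tau> h))"
  unfolding tmD.simps Let_def
  by (rule related_eq[OF related_app[OF tmD_coherent tmD_coherent tmD_closed tmD_closed]])
    (use someI[of "\<lambda>\<sigma>. typing S \<Gamma> M (FunT \<sigma> \<tau>) \<and> typing S \<Gamma> N \<sigma>", OF conjI[OF assms(1,2)]] assms
      in simp_all)

end

section \<open>Weakening and substitution\<close>

text \<open>Weakening at the outer end of the context leaves de Bruijn indices alone; no other
  weakening arises, because only closed terms are substituted.\<close>

lemma typing_append: "typing S \<Gamma> M \<sigma> \<Longrightarrow> typing S (\<Gamma> @ \<Delta>) M \<sigma>"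
proof (induction rule: typing.induct)
  case (ty_Var i \<Gamma>)
  then show ?case using typing.ty_Var[of i "\<Gamma> @ \<Delta>"] by (simp add: nth_append)
next
  case (ty_FApp \<Gamma> Ms f)
  then show ?case by (auto intro!: typing.ty_FApp elim!: list_all2_mono)
next
  case (ty_Op \<Gamma> Ns p Ms \<sigma>)
  then show ?case by (auto intro!: typing.ty_Op elim!: list_all2_mono)
qed (auto intro: typing.intros)

lemma lift_typed: "typing S \<Gamma> M \<sigma> \<Longrightarrow> length \<Gamma> \<le> k \<Longrightarrow> lift k M = M"
  by (induction arbitrary: k rule: typing.induct)
    (auto intro!: map_idI simp: list_all2_conv_all_nth in_set_conv_nth)

lemma subst_typed: "typing S \<Gamma> M \<sigma> \<Longrightarrow> length \<Gamma> \<le> k \<Longrightarrow> subst M k P = M"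
  by (induction arbitrary: k P rule: typing.induct)
    (auto intro!: map_idI simp: list_all2_conv_all_nth in_set_conv_nth)

text \<open>It suffices to replace the outermost variable by a closed term: a beta step on a program
  is the case of empty \<open>\<Gamma>\<close>, and below binders the variable stays outermost while
  \<open>lift_typed\<close> cancels the lifting.\<close>

lemma typing_subst:
  assumes V: "typing S [] V \<upsilon>"
  shows "typing S (\<Gamma> @ [\<upsilon>]) M \<sigma> \<Longrightarrow> typing S \<Gamma> (subst M (length \<Gamma>) V) \<sigma>"
proof (induction "\<Gamma> @ [\<upsilon>]" M \<sigma> arbitrary: \<Gamma> rule: typing.induct)
  case (ty_Var i)
  then show ?case
    using typing.ty_Var[of i \<Gamma>] typing_append[OF V, of \<Gamma>] by (auto simp: nth_append)
next
  case (ty_FApp Ms f)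
  then show ?case
    by (auto intro!: typing.ty_FApp simp: list_all2_map1 elim!: list_all2_mono)
next
  case (ty_Op Ns p Ms \<sigma>)
  then show ?case
    by (auto intro!: typing.ty_Op simp: list_all2_map1 elim!: list_all2_mono)
next
  case (ty_Lam \<sigma> M \<tau>)
  from ty_Lam.hyps(2)[of "\<sigma> # \<Gamma>"] show ?case
    by (auto intro!: typing.ty_Lam simp: lift_typed[OF V])
qed (auto intro: typing.intros)

section \<open>Denotations under weakening and substitution\<close>

lemma argsD_map:
  "list_all2 (\<lambda>M b. tmD S I (g M) \<Gamma>' (BaseT b) \<rho>' = tmD S I M \<Gamma> (BaseT b) \<rho>) Ms bs \<Longrightarrow>
    argsD S I bs (map g Ms) \<Gamma>' \<rho>' = argsD S I bs Ms \<Gamma> \<rho>"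
  by (induction rule: list_all2_induct) auto

lemma envs_append: "\<rho> \<in> envs I \<Gamma> \<Longrightarrow> \<delta> \<in> envs I \<Delta> \<Longrightarrow> \<rho> @ \<delta> \<in> envs I (\<Gamma> @ \<Delta>)"
  by (auto simp: envs_def intro: list_all2_appendI)

lemma envs_Cons [simp]: "a # \<rho> \<in> envs I (\<sigma> # \<Gamma>) \<longleftrightarrow> a \<in> tyD I \<sigma> \<and> \<rho> \<in> envs I \<Gamma>"
  by (simp add: envs_def)

lemma envs_Nil [simp]: "\<rho> \<in> envs I [] \<longleftrightarrow> \<rho> = []"
  by (simp add: envs_def)

lemma envs_length: "\<rho> \<in> envs I \<Gamma> \<Longrightarrow> length \<rho> = length \<Gamma>"
  by (auto simp: envs_def list_all2_lengthD)

context set_model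
begin

lemma tmD_append:
  assumes \<delta>: "\<delta> \<in> envs I \<Delta>"
  shows "typing S \<Gamma> M \<sigma> \<Longrightarrow> \<rho> \<in> envs I \<Gamma> \<Longrightarrow> tmD S I M (\<Gamma> @ \<Delta>) \<sigma> (\<rho> @ \<delta>) = tmD S I M \<Gamma> \<sigma> \<rho>"
proof (induction arbitrary: \<rho> rule: typing.induct)
  case (ty_Var i \<Gamma>)
  then show ?case by (simp add: nth_append envs_length)
next
  case (ty_FApp \<Gamma> Ms f)
  \<comment> \<open>The trivial \<open>map id\<close> brings the list into the form of
    \<open>argsD_map\<close>.\<close>
  have "argsD S I (funArgs S f) (map id Ms) (\<Gamma> @ \<Delta>) (\<rho> @ \<delta>) = argsD S I (funArgs S f) Ms \<Gamma> \<rho>"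
    by (rule argsD_map) (use ty_FApp in \<open>auto elim!: list_all2_mono\<close>)
  then show ?case by (simp only: tmD_FApp list.map_id)
next
  case (ty_Op \<Gamma> Ns p Ms \<sigma>)
  have "argsD S I (opPars S p) (map id Ns) (\<Gamma> @ \<Delta>) (\<rho> @ \<delta>) = argsD S I (opPars S p) Ns \<Gamma> \<rho>"
    by (rule argsD_map) (use ty_Op in \<open>auto elim!: list_all2_mono\<close>)
  moreover have "map (\<lambda>M. tmD S I M (\<Gamma> @ \<Delta>) \<sigma> (\<rho> @ \<delta>)) Ms = map (\<lambda>M. tmD S I M \<Gamma> \<sigma> \<rho>) Ms"
    using ty_Op by simp
  ultimately show ?case by (simp only: tmD_Op list.map_id)
next
  case (ty_Fst \<Gamma> M \<sigma> \<tau>)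
  then show ?case by (simp only: tmD_Fst[where \<tau> = \<tau>] typing_append envs_append \<delta>)
next
  case (ty_Snd \<Gamma> M \<sigma> \<tau>)
  then show ?case by (simp only: tmD_Snd[where \<sigma> = \<sigma>] typing_append envs_append \<delta>)
next
  case (ty_App \<Gamma> M \<sigma> \<tau> N)
  then show ?case by (simp only: tmD_App[where \<sigma> = \<sigma>] typing_append envs_append \<delta>)
next
  case (ty_Lam \<sigma> \<Gamma> M \<tau>)
  have "tmD S I M ((\<sigma> # \<Gamma>) @ \<Delta>) \<tau> ((a # \<rho>) @ \<delta>) = tmD S I M (\<sigma> # \<Gamma>) \<tau> (a # \<rho>)" if "a \<in> tyD I \<sigma>" for a
    using ty_Lam.IH[of "a # \<rho>"] ty_Lam.prems that by simp
  then show ?case by (simp cong: restrict_cong)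
next
  case (ty_Cond \<Gamma> L M \<sigma> N)
  then show ?case by (simp cong: if_cong)
qed simp_all

text \<open>Environments hold values and not computations, so the substituted term has to denote a
  pure computation; \<open>value_denotes\<close> supplies this in the beta case.\<close>

lemma tmD_subst:
  assumes V: "typing S [] V \<upsilon>" "tmD S I V [] \<upsilon> [] = eta I (tyD I \<upsilon>) v" and v: "v \<in> tyD I \<upsilon>"
  shows "typing S (\<Gamma> @ [\<upsilon>]) M \<sigma> \<Longrightarrow> \<rho> \<in> envs I \<Gamma> \<Longrightarrow>
    tmD S I (subst M (length \<Gamma>) V) \<Gamma> \<sigma> \<rho> = tmD S I M (\<Gamma> @ [\<upsilon>]) \<sigma> (\<rho> @ [v])"
proof (induction "\<Gamma> @ [\<upsilon>]" M \<sigma> arbitrary: \<Gamma> \<rho> rule: typing.induct)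
  case (ty_Var i)
  then show ?case
    \<comment> \<open>By weakening, the inserted \<open>V\<close> denotes in \<open>\<Gamma>\<close>
      what it denotes in the empty context.\<close>
    using tmD_append[of \<rho> \<Gamma> "[]" V \<upsilon> "[]"] V by (auto simp: nth_append envs_length)
next
  case (ty_FApp Ms f)
  have "argsD S I (funArgs S f) (map (\<lambda>M. subst M (length \<Gamma>) V) Ms) \<Gamma> \<rho> =
      argsD S I (funArgs S f) Ms (\<Gamma> @ [\<upsilon>]) (\<rho> @ [v])"
    by (rule argsD_map) (use ty_FApp in \<open>auto elim!: list_all2_mono\<close>)
  then show ?case by (simp only: tmD_FApp subst.simps)
next
  case (ty_Op Ns p Ms \<sigma>)
  have "argsD S I (opPars S p) (map (\<lambda>M. subst M (length \<Gamma>) V) Ns) \<Gamma> \<rho> =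
      argsD S I (opPars S p) Ns (\<Gamma> @ [\<upsilon>]) (\<rho> @ [v])"
    by (rule argsD_map) (use ty_Op in \<open>auto elim!: list_all2_mono\<close>)
  moreover have "map (\<lambda>M. tmD S I M \<Gamma> \<sigma> \<rho>) (map (\<lambda>M. subst M (length \<Gamma>) V) Ms) =
      map (\<lambda>M. tmD S I M (\<Gamma> @ [\<upsilon>]) \<sigma> (\<rho> @ [v])) Ms"
    using ty_Op by simp
  ultimately show ?case by (simp only: tmD_Op subst.simps)
next
  case (ty_Fst M \<sigma> \<tau>)
  then show ?case
    using v by (simp only: tmD_Fst[where \<tau> = \<tau>] typing_subst[OF V(1)] envs_append envs_Cons envs_Nil subst.simps simp_thms)
next
  case (ty_Snd M \<sigma> \<tau>)
  then show ?case
    using v by (simp only: tmD_Snd[where \<sigma> = \<sigma>] typing_subst[OF V(1)] envs_append envs_Cons envs_Nil subst.simps simp_thms)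
next
  case (ty_App M \<sigma> \<tau> N)
  then show ?case
    using v by (simp only: tmD_App[where \<sigma> = \<sigma>] typing_subst[OF V(1)] envs_append envs_Cons envs_Nil subst.simps simp_thms)
next
  case (ty_Lam \<sigma> M \<tau>)
  have "tmD S I (subst M (Suc (length \<Gamma>)) V) (\<sigma> # \<Gamma>) \<tau> (a # \<rho>) =
      tmD S I M (\<sigma> # \<Gamma> @ [\<upsilon>]) \<tau> (a # \<rho> @ [v])" if "a \<in> tyD I \<sigma>" for a
    using ty_Lam.hyps(2)[of "\<sigma> # \<Gamma>" "a # \<rho>"] ty_Lam.prems that by simp
  then show ?case by (simp add: lift_typed[OF V(1)] cong: restrict_cong)
next
  case (ty_Cond L M \<sigma> N)
  then show ?case by (simp cong: if_cong)
qed simp_all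

section \<open>Values and redexes\<close>

lemma tmD_Pair_values:
  assumes v: "v \<in> tyD I \<sigma>" "tmD S I V [] \<sigma> [] = eta I (tyD I \<sigma>) v"
    and w: "w \<in> tyD I \<tau>" "tmD S I W [] \<tau> [] = eta I (tyD I \<tau>) w"
  shows "tmD S I (Pair V W) [] (ProdT \<sigma> \<tau>) [] = eta I (tyD I (ProdT \<sigma> \<tau>)) (pair I v w)"
    and "pair I v w \<in> tyD I (ProdT \<sigma> \<tau>)"
proof -
  have pair: "pair I x y \<in> tyD I (ProdT \<sigma> \<tau>)" if "x \<in> tyD I \<sigma>" "y \<in> tyD I \<tau>" for x y
    using that by auto
  show "pair I v w \<in> tyD I (ProdT \<sigma> \<tau>)" using v w by auto
  show "tmD S I (Pair V W) [] (ProdT \<sigma> \<tau>) [] = eta I (tyD I (ProdT \<sigma> \<tau>)) (pair I v w)"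
    using pair v w by (simp add: bindD_eta bindD_closed eta_closed del: tyD.simps)
qed

text \<open>Purity of values makes the evaluated parts of a context transparent: sequencing such a
  computation merely passes on \<open>v\<close>.\<close>

lemma value_denotes:
  "is_value V \<Longrightarrow> typing S [] V \<sigma> \<Longrightarrow> \<exists>v \<in> tyD I \<sigma>. tmD S I V [] \<sigma> [] = eta I (tyD I \<sigma>) v"
proof (induction arbitrary: \<sigma> rule: is_value.induct)
  case (1 c)
  then show ?case using const_closed by (fastforce elim!: typing_ConstE)
next
  case 2
  then show ?case by (auto elim!: typing_StarE)
next
  case (3 V W)
  from 3(5) obtain \<sigma>1 \<sigma>2 where \<sigma>: "\<sigma> = ProdT \<sigma>1 \<sigma>2" "typing S [] V \<sigma>1" "typing S [] W \<sigma>2"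
    by (auto elim: typing_PairE)
  with 3 obtain v w where v: "v \<in> tyD I \<sigma>1" "tmD S I V [] \<sigma>1 [] = eta I (tyD I \<sigma>1) v"
    and w: "w \<in> tyD I \<sigma>2" "tmD S I W [] \<sigma>2 [] = eta I (tyD I \<sigma>2) w"
    by blast
  then show ?case
    unfolding \<sigma>(1) using tmD_Pair_values by blast
next
  case (4 \<tau> M)
  then obtain \<tau>' where \<sigma>: "\<sigma> = FunT \<tau> \<tau>'" and M: "typing S [\<tau>] M \<tau>'"
    by (auto elim: typing_LamE)
  have "(\<lambda>a \<in> tyD I \<tau>. tmD S I M [\<tau>] \<tau>' [a]) \<in> tyD I \<tau> \<rightarrow>\<^sub>E T I (tyD I \<tau>')"
    using tmD_closed[OF M] by auto
  then show ?case
    by (simp only: \<sigma> tmD.simps tyD.simps ty.case) blast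
qed

lemma bindsD_consts:
  "(\<And>xs. list_all2 (\<lambda>x b. x \<in> base I b) xs (map (constT S) cs) \<Longrightarrow> k xs \<in> T I Y) \<Longrightarrow>
    bindsD I (argsD S I (map (constT S) cs) (map Const cs) \<Gamma> \<rho>) Y k = k (map (constD I) cs)"
proof (induction cs arbitrary: k)
  case (Cons c cs)
  have args: "list_all2 (\<lambda>M b. tmD S I M \<Gamma> (BaseT b) \<rho> \<in> T I (base I b)) (map Const cs) (map (constT S) cs)"
    by (simp add: list_all2_conv_all_nth eta_closed const_closed)
  have "bindsD I (argsD S I (map (constT S) (c # cs)) (map Const (c # cs)) \<Gamma> \<rho>) Y k =
      bindsD I (argsD S I (map (constT S) cs) (map Const cs) \<Gamma> \<rho>) Y (\<lambda>xs. k (constD I c # xs))"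
    using bindsD_args_closed[OF args] Cons.prems by (simp add: bindD_eta const_closed)
  also have "\<dots> = k (map (constD I) (c # cs))"
    using Cons.prems by (simp add: Cons.IH const_closed)
  finally show ?case .
qed simp

lemma typing_consts:
  "list_all2 (\<lambda>M b. typing S \<Gamma> M (BaseT b)) (map Const cs) bs \<Longrightarrow> bs = map (constT S) cs"
  by (induction cs arbitrary: bs) (auto simp: list_all2_Cons1 elim: typing_ConstE)

text \<open>Typing is carried along because \<open>tmD\<close> is meaningful only at derivable
  types.\<close>

lemma redex_sound:
  "redex S Q Q' \<Longrightarrow> typing S [] Q \<sigma> \<Longrightarrow> typing S [] Q' \<sigma> \<and> tmD S I Q' [] \<sigma> [] = tmD S I Q [] \<sigma> []"
proof (induction rule: redex.induct)
  case (1 cs f)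
  from 1(2) have \<sigma>: "\<sigma> = BaseT (constT S (funVal S f cs))"
    by (auto elim: typing_FAppE simp: val_type[OF 1(1)])
  have "tmD S I (FApp f (map Const cs)) [] \<sigma> [] = eta I (tyD I \<sigma>) (funD I f (map (constD I) cs))"
    unfolding tmD_FApp 1(1)[symmetric]
    by (rule bindsD_consts)
      (use fun_closed[of _ f] 1(1) val_type[OF 1(1)] in \<open>simp add: \<sigma> eta_closed\<close>)
  then show ?case
    by (simp add: \<sigma> fun_val[OF 1(1)] typing.ty_Const)
next
  case (2 M N)
  then have "typing S [] M \<sigma>" "typing S [] N \<sigma>" by (auto elim: typing_CondE)
  then show ?case by (simp add: const_tt bindD_eta base_bool tmD_closed)
next
  case (3 M N)
  then have "typing S [] M \<sigma>" "typing S [] N \<sigma>" by (auto elim: typing_CondE)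
  \<comment> \<open>The semantics takes the second branch when the test against
    \<open>num I 1\<close> fails, so the two codes must differ.\<close>
  moreover have "num I 0 \<noteq> num I 1" using num_inj by (auto dest: injD)
  ultimately show ?case by (simp add: const_ff bindD_eta base_bool tmD_closed)
next
  case (4 V W)
  then obtain \<tau> where VW: "typing S [] V \<sigma>" "typing S [] W \<tau>" "typing S [] (Pair V W) (ProdT \<sigma> \<tau>)"
    by (auto elim!: typing_FstE typing_PairE intro: typing.ty_Pair)
  obtain v w where v: "v \<in> tyD I \<sigma>" "tmD S I V [] \<sigma> [] = eta I (tyD I \<sigma>) v"
    and w: "w \<in> tyD I \<tau>" "tmD S I W [] \<tau> [] = eta I (tyD I \<tau>) w"
    using value_denotes 4 VW by meson
  show ?case
    using VW v
    by (simp add: tmD_Fst[OF VW(3)] tmD_Pair_values[OF v w] bindD_eta eta_closed fstD_closed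
        del: tyD.simps tmD.simps)
next
  case (5 V W)
  then obtain \<tau> where VW: "typing S [] V \<tau>" "typing S [] W \<sigma>" "typing S [] (Pair V W) (ProdT \<tau> \<sigma>)"
    by (auto elim!: typing_SndE typing_PairE intro: typing.ty_Pair)
  obtain v w where v: "v \<in> tyD I \<tau>" "tmD S I V [] \<tau> [] = eta I (tyD I \<tau>) v"
    and w: "w \<in> tyD I \<sigma>" "tmD S I W [] \<sigma> [] = eta I (tyD I \<sigma>) w"
    using value_denotes 5 VW by meson
  show ?case
    using VW w
    by (simp add: tmD_Snd[OF VW(3)] tmD_Pair_values[OF v w] bindD_eta eta_closed sndD_closed
        del: tyD.simps tmD.simps)
next
  case (6 V \<tau> M)
  then have M: "typing S [\<tau>] M \<sigma>" and V: "typing S [] V \<tau>" and L: "typing S [] (Lam \<tau> M) (FunT \<tau> \<sigma>)"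
    by (auto elim!: typing_AppE typing_LamE intro: typing.ty_Lam)
  obtain v where v: "v \<in> tyD I \<tau>" "tmD S I V [] \<tau> [] = eta I (tyD I \<tau>) v"
    using value_denotes 6 V by meson
  define h where "h = (\<lambda>a \<in> tyD I \<tau>. tmD S I M [\<tau>] \<sigma> [a])"
  have h: "h \<in> tyD I \<tau> \<rightarrow>\<^sub>E T I (tyD I \<sigma>)"
    unfolding h_def using tmD_closed[OF M] by auto
  have fn: "fn I h \<in> tyD I (FunT \<tau> \<sigma>)" using h by (simp del: PiE_iff)
  have "tmD S I (Lam \<tau> M) [] (FunT \<tau> \<sigma>) [] = eta I (tyD I (FunT \<tau> \<sigma>)) (fn I h)"
    by (simp only: tmD.simps ty.case h_def)
  then have "tmD S I (App (Lam \<tau> M) V) [] \<sigma> [] = appD I \<tau> \<sigma> (fn I h) v"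
    by (simp add: tmD_App[OF L V] v fn bindD_eta bindD_closed eta_closed appD_closed
        del: tyD.simps tmD.simps)
  also have "\<dots> = tmD S I M [\<tau>] \<sigma> [v]"
    unfolding appD_fn[OF h] using v(1) by (simp add: h_def)
  also have "\<dots> = tmD S I (subst M 0 V) [] \<sigma> []"
    using tmD_subst[OF V v(2,1), of "[]"] M by simp
  finally show ?case using typing_subst[OF V, of "[]"] M by simp
qed

end

section \<open>Evaluation contexts\<close>

text \<open>\<open>k\<close> is fixed before \<open>Q\<close>, so that different programs in the
  hole can be compared and an operation can be pulled out. Maps \<open>F\<close> on terms replace
  contexts so that single frames and the identity are instances, which \<open>factors_comp\<close>
  composes.\<close>

definition factors ::
  "('b, 'c, 'f, 'o) signature \<Rightarrow> ('b, 'c, 'f, 'o, 'u, 't) model \<Rightarrow>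
    (('b, 'c, 'f, 'o) tm \<Rightarrow> ('b, 'c, 'f, 'o) tm) \<Rightarrow> 'b ty \<Rightarrow> 'b ty \<Rightarrow> bool" where
  "factors S I F \<tau> \<sigma> \<longleftrightarrow> (\<exists>k \<in> tyD I \<tau> \<rightarrow> T I (tyD I \<sigma>). \<forall>Q. typing S [] Q \<tau> \<longrightarrow>
    typing S [] (F Q) \<sigma> \<and> tmD S I (F Q) [] \<sigma> [] = bindD I (tyD I \<tau>) (tyD I \<sigma>) (tmD S I Q [] \<tau> []) k)"

lemma factorsI:
  assumes "\<And>x. x \<in> tyD I \<tau> \<Longrightarrow> k x \<in> T I (tyD I \<sigma>)"
    and "\<And>Q. typing S [] Q \<tau> \<Longrightarrow> typing S [] (F Q) \<sigma>"
    and "\<And>Q. typing S [] Q \<tau> \<Longrightarrow>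
      tmD S I (F Q) [] \<sigma> [] = bindD I (tyD I \<tau>) (tyD I \<sigma>) (tmD S I Q [] \<tau> []) k"
  shows "factors S I F \<tau> \<sigma>"
  using assms unfolding factors_def by blast

context set_model
begin

lemma factors_comp:
  assumes "factors S I G \<upsilon> \<tau>" "factors S I F \<tau> \<sigma>"
  shows "factors S I (\<lambda>Q. F (G Q)) \<upsilon> \<sigma>"
proof -
  obtain k where k: "k \<in> tyD I \<upsilon> \<rightarrow> T I (tyD I \<tau>)" "\<And>Q. typing S [] Q \<upsilon> \<Longrightarrow> typing S [] (G Q) \<tau>"
      "\<And>Q. typing S [] Q \<upsilon> \<Longrightarrow>
        tmD S I (G Q) [] \<tau> [] = bindD I (tyD I \<upsilon>) (tyD I \<tau>) (tmD S I Q [] \<upsilon> []) k"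
    using assms(1) unfolding factors_def by blast
  obtain l where l: "l \<in> tyD I \<tau> \<rightarrow> T I (tyD I \<sigma>)" "\<And>Q. typing S [] Q \<tau> \<Longrightarrow> typing S [] (F Q) \<sigma>"
      "\<And>Q. typing S [] Q \<tau> \<Longrightarrow>
        tmD S I (F Q) [] \<sigma> [] = bindD I (tyD I \<tau>) (tyD I \<sigma>) (tmD S I Q [] \<tau> []) l"
    using assms(2) unfolding factors_def by blast
  show ?thesis
  proof (rule factorsI[of _ _ "\<lambda>x. bindD I (tyD I \<tau>) (tyD I \<sigma>) (k x) l"])
    fix Q assume Q: "typing S [] Q \<upsilon>"
    have "tmD S I (F (G Q)) [] \<sigma> [] = bindD I (tyD I \<tau>) (tyD I \<sigma>)
        (bindD I (tyD I \<upsilon>) (tyD I \<tau>) (tmD S I Q [] \<upsilon> []) k) l"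
      using k(2,3) l(3) Q by simp
    also have "\<dots> = bindD I (tyD I \<upsilon>) (tyD I \<sigma>) (tmD S I Q [] \<upsilon> [])
        (\<lambda>x. bindD I (tyD I \<tau>) (tyD I \<sigma>) (k x) l)"
      by (rule bindD_assoc) (use tmD_closed[OF Q] k(1) l(1) in auto)
    finally show "tmD S I (F (G Q)) [] \<sigma> [] = bindD I (tyD I \<upsilon>) (tyD I \<sigma>) (tmD S I Q [] \<upsilon> [])
        (\<lambda>x. bindD I (tyD I \<tau>) (tyD I \<sigma>) (k x) l)" .
  qed (use k l in \<open>auto intro!: bindD_closed\<close>)
qed

text \<open>Constants left of the hole are pure, so \<open>k\<close> absorbs their denotations one
  by one. The arguments right of the hole go into \<open>j\<close>, which does not depend on the
  term in the hole.\<close>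

lemma bindsD_args_factor:
  assumes "list_all2 (\<lambda>M b. typing S [] M (BaseT b)) (map Const cs @ N # Ms) bs"
    and "\<And>xs. list_all2 (\<lambda>x b. x \<in> base I b) xs bs \<Longrightarrow> k xs \<in> T I Y"
  shows "\<exists>b j. typing S [] N (BaseT b) \<and> j \<in> base I b \<rightarrow> T I Y \<and> (\<forall>Q. typing S [] Q (BaseT b) \<longrightarrow>
    list_all2 (\<lambda>M b. typing S [] M (BaseT b)) (map Const cs @ Q # Ms) bs \<and>
    bindsD I (argsD S I bs (map Const cs @ Q # Ms) [] []) Y k =
      bindD I (base I b) Y (tmD S I Q [] (BaseT b) []) j)"
  using assms
proof (induction cs arbitrary: bs k)
  case Nil
  then obtain b bs' where bs: "bs = b # bs'" and N: "typing S [] N (BaseT b)"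
    and Ms: "list_all2 (\<lambda>M b. typing S [] M (BaseT b)) Ms bs'"
    by (auto simp: list_all2_Cons1)
  let ?j = "\<lambda>x. bindsD I (argsD S I bs' Ms [] []) Y (\<lambda>xs. k (x # xs))"
  have "?j \<in> base I b \<rightarrow> T I Y"
    using tmD_args_closed[OF Ms] Nil.prems(2) bs by (auto intro!: bindsD_args_closed)
  then show ?case
    using N Ms bs by auto
next
  case (Cons c cs)
  then obtain bs' where bs: "bs = constT S c # bs'"
    and *: "list_all2 (\<lambda>M b. typing S [] M (BaseT b)) (map Const cs @ N # Ms) bs'"
    by (auto simp: list_all2_Cons1 elim: typing_ConstE)
  have k: "k (x # xs) \<in> T I Y" if "x \<in> base I (constT S c)" "list_all2 (\<lambda>x b. x \<in> base I b) xs bs'" for x xs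
    using Cons.prems(2) that bs by simp
  from Cons.IH[OF *, of "\<lambda>xs. k (constD I c # xs)"] k const_closed obtain b j
    where b: "typing S [] N (BaseT b)" "j \<in> base I b \<rightarrow> T I Y"
      and j: "\<And>Q. typing S [] Q (BaseT b) \<Longrightarrow>
        list_all2 (\<lambda>M b. typing S [] M (BaseT b)) (map Const cs @ Q # Ms) bs' \<and>
        bindsD I (argsD S I bs' (map Const cs @ Q # Ms) [] []) Y (\<lambda>xs. k (constD I c # xs)) =
          bindD I (base I b) Y (tmD S I Q [] (BaseT b) []) j"
    by blast
  have "bindsD I (argsD S I bs (map Const (c # cs) @ Q # Ms) [] []) Y k =
      bindsD I (argsD S I bs' (map Const cs @ Q # Ms) [] []) Y (\<lambda>xs. k (constD I c # xs))"
    if "typing S [] Q (BaseT b)" for Q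
    using bindsD_args_closed[OF tmD_args_closed] j[OF that] k const_closed
    by (simp add: bs bindD_eta)
  with b j show ?case
    by (intro exI[of _ b] exI[of _ j]) (simp add: bs typing.ty_Const)
qed

text \<open>The hole type is read off from a typing of the filled context, since \<open>Q\<close>
  need not have only one type. Each frame contributes what its semantics does after the first
  effectful computation, and the frames are composed.\<close>

lemma fill_factors:
  "is_ectx C \<Longrightarrow> typing S [] (fill C Q) \<sigma> \<Longrightarrow> \<exists>\<tau>. typing S [] Q \<tau> \<and> factors S I (fill C) \<tau> \<sigma>"
proof (induction C arbitrary: \<sigma>)
  case Hole
  have "factors S I (fill Hole) \<sigma> \<sigma>"
    by (rule factorsI[of _ _ "eta I (tyD I \<sigma>)"]) (simp_all add: eta_closed bindD_eta_right tmD_closed)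
  moreover have "typing S [] Q \<sigma>" using Hole by simp
  ultimately show ?case by blast
next
  case (EFApp f cs C Ms)
  then have \<sigma>: "\<sigma> = BaseT (funRes S f)"
    and Ns: "list_all2 (\<lambda>M b. typing S [] M (BaseT b)) (map Const cs @ fill C Q # Ms) (funArgs S f)"
    by (auto elim: typing_FAppE)
  obtain b j where b: "typing S [] (fill C Q) (BaseT b)" and j: "j \<in> base I b \<rightarrow> T I (tyD I \<sigma>)"
      "\<And>Q. typing S [] Q (BaseT b) \<Longrightarrow>
        list_all2 (\<lambda>M b. typing S [] M (BaseT b)) (map Const cs @ Q # Ms) (funArgs S f) \<and>
        bindsD I (argsD S I (funArgs S f) (map Const cs @ Q # Ms) [] []) (tyD I \<sigma>)
          (\<lambda>xs. eta I (tyD I \<sigma>) (funD I f xs)) =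
        bindD I (base I b) (tyD I \<sigma>) (tmD S I Q [] (BaseT b) []) j"
    using bindsD_args_factor[OF Ns, of "\<lambda>xs. eta I (tyD I \<sigma>) (funD I f xs)" "tyD I \<sigma>"]
    by (auto simp: \<sigma> eta_closed fun_closed)
  have "factors S I (\<lambda>N. FApp f (map Const cs @ N # Ms)) (BaseT b) \<sigma>"
    by (rule factorsI[of _ _ j]) (use j \<sigma> in \<open>auto simp: tmD_FApp simp del: tmD.simps intro: typing.ty_FApp\<close>)
  moreover obtain \<tau> where "typing S [] Q \<tau>" "factors S I (fill C) \<tau> (BaseT b)"
    using EFApp.IH EFApp.prems b by auto
  ultimately show ?case using factors_comp by fastforce
next
  case (ECond C M N)
  then have L: "typing S [] (fill C Q) (BaseT (boolT S))" and MN: "typing S [] M \<sigma>" "typing S [] N \<sigma>"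
    by (auto elim: typing_CondE)
  have "factors S I (\<lambda>L. Cond L M N) (BaseT (boolT S)) \<sigma>"
    by (rule factorsI[of _ _ "\<lambda>x. if x = num I 1 then tmD S I M [] \<sigma> [] else tmD S I N [] \<sigma> []"])
      (use MN in \<open>auto intro: typing.ty_Cond simp: tmD_closed\<close>)
  moreover obtain \<tau> where "typing S [] Q \<tau>" "factors S I (fill C) \<tau> (BaseT (boolT S))"
    using ECond.IH ECond.prems L by auto
  ultimately show ?case using factors_comp by fastforce
next
  case (EOp p cs C Ns Ms)
  then have Ns: "list_all2 (\<lambda>M b. typing S [] M (BaseT b)) (map Const cs @ fill C Q # Ns) (opPars S p)"
    and Ms: "length Ms = opArity S p" "\<forall>M \<in> set Ms. typing S [] M \<sigma>"
    by (auto elim: typing_OpE)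
  let ?k = "\<lambda>xs. opD S I p (tyD I \<sigma>) xs (map (\<lambda>M. tmD S I M [] \<sigma> []) Ms)"
  have k: "?k xs \<in> T I (tyD I \<sigma>)" if "list_all2 (\<lambda>x b. x \<in> base I b) xs (opPars S p)" for xs
    by (rule opD_closed[OF that]) (use Ms in \<open>auto simp: tmD_closed\<close>)
  obtain b j where b: "typing S [] (fill C Q) (BaseT b)" and j: "j \<in> base I b \<rightarrow> T I (tyD I \<sigma>)"
      "\<And>Q. typing S [] Q (BaseT b) \<Longrightarrow>
        list_all2 (\<lambda>M b. typing S [] M (BaseT b)) (map Const cs @ Q # Ns) (opPars S p) \<and>
        bindsD I (argsD S I (opPars S p) (map Const cs @ Q # Ns) [] []) (tyD I \<sigma>) ?k =
        bindD I (base I b) (tyD I \<sigma>) (tmD S I Q [] (BaseT b) []) j"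
    using bindsD_args_factor[OF Ns, of ?k "tyD I \<sigma>"] k by auto
  have "factors S I (\<lambda>N. Op p (map Const cs @ N # Ns) Ms) (BaseT b) \<sigma>"
    by (rule factorsI[of _ _ j]) (use j Ms in \<open>auto simp: tmD_Op simp del: tmD.simps intro: typing.ty_Op\<close>)
  moreover obtain \<tau> where "typing S [] Q \<tau>" "factors S I (fill C) \<tau> (BaseT b)"
    using EOp.IH EOp.prems b by auto
  ultimately show ?case using factors_comp by fastforce
next
  case (EPairL C N)
  then obtain \<sigma>1 \<sigma>2 where \<sigma>: "\<sigma> = ProdT \<sigma>1 \<sigma>2" and M: "typing S [] (fill C Q) \<sigma>1" and N: "typing S [] N \<sigma>2"
    by (auto elim: typing_PairE)
  have pair: "pair I x y \<in> tyD I \<sigma>" if "x \<in> tyD I \<sigma>1" "y \<in> tyD I \<sigma>2" for x y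
    using that \<sigma> by auto
  have "factors S I (\<lambda>M. Pair M N) \<sigma>1 \<sigma>"
    by (rule factorsI[of _ _ "\<lambda>x. bindD I (tyD I \<sigma>2) (tyD I \<sigma>) (tmD S I N [] \<sigma>2 [])
          (\<lambda>y. eta I (tyD I \<sigma>) (pair I x y))"])
      (use N pair \<sigma> in \<open>auto intro!: typing.ty_Pair bindD_closed tmD_closed eta_closed simp del: tyD.simps\<close>)
  moreover obtain \<tau> where "typing S [] Q \<tau>" "factors S I (fill C) \<tau> \<sigma>1"
    using EPairL.IH EPairL.prems M by auto
  ultimately show ?case using factors_comp by fastforce
next
  case (EPairR V C)
  then obtain \<sigma>1 \<sigma>2 where \<sigma>: "\<sigma> = ProdT \<sigma>1 \<sigma>2" and V: "typing S [] V \<sigma>1" and N: "typing S [] (fill C Q) \<sigma>2"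
    by (auto elim: typing_PairE)
  \<comment> \<open>The left component is pure, so the hole still comes first.\<close>
  obtain v where v: "v \<in> tyD I \<sigma>1" "tmD S I V [] \<sigma>1 [] = eta I (tyD I \<sigma>1) v"
    using value_denotes[OF _ V] EPairR.prems by auto
  have pair: "pair I x y \<in> tyD I \<sigma>" if "x \<in> tyD I \<sigma>1" "y \<in> tyD I \<sigma>2" for x y
    using that \<sigma> by auto
  have "factors S I (Pair V) \<sigma>2 \<sigma>"
  proof (rule factorsI[of _ _ "\<lambda>y. eta I (tyD I \<sigma>) (pair I v y)"])
    fix N assume N: "typing S [] N \<sigma>2"
    show "tmD S I (Pair V N) [] \<sigma> [] =
        bindD I (tyD I \<sigma>2) (tyD I \<sigma>) (tmD S I N [] \<sigma>2 []) (\<lambda>y. eta I (tyD I \<sigma>) (pair I v y))"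
      using v N pair unfolding \<sigma>
      by (simp add: bindD_eta bindD_closed tmD_closed eta_closed del: tyD.simps)
  qed (use V v pair \<sigma> in \<open>auto intro!: typing.ty_Pair eta_closed simp del: tyD.simps\<close>)
  moreover obtain \<tau> where "typing S [] Q \<tau>" "factors S I (fill C) \<tau> \<sigma>2"
    using EPairR.IH EPairR.prems N by auto
  ultimately show ?case using factors_comp by fastforce
next
  case (EFst C)
  then obtain \<upsilon> where M: "typing S [] (fill C Q) (ProdT \<sigma> \<upsilon>)"
    by (auto elim: typing_FstE)
  have "factors S I Fst (ProdT \<sigma> \<upsilon>) \<sigma>"
    by (rule factorsI[of _ _ "\<lambda>z. eta I (tyD I \<sigma>) (fstD I z)"])
      (auto intro: typing.ty_Fst eta_closed fstD_closed simp: tmD_Fst simp del: tyD.simps tmD.simps)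
  moreover obtain \<tau> where "typing S [] Q \<tau>" "factors S I (fill C) \<tau> (ProdT \<sigma> \<upsilon>)"
    using EFst.IH EFst.prems M by auto
  ultimately show ?case using factors_comp by fastforce
next
  case (ESnd C)
  then obtain \<upsilon> where M: "typing S [] (fill C Q) (ProdT \<upsilon> \<sigma>)"
    by (auto elim: typing_SndE)
  have "factors S I Snd (ProdT \<upsilon> \<sigma>) \<sigma>"
    by (rule factorsI[of _ _ "\<lambda>z. eta I (tyD I \<sigma>) (sndD I z)"])
      (auto intro: typing.ty_Snd eta_closed sndD_closed simp: tmD_Snd simp del: tyD.simps tmD.simps)
  moreover obtain \<tau> where "typing S [] Q \<tau>" "factors S I (fill C) \<tau> (ProdT \<upsilon> \<sigma>)"
    using ESnd.IH ESnd.prems M by auto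
  ultimately show ?case using factors_comp by fastforce
next
  case (EAppL C N)
  then obtain \<upsilon> where M: "typing S [] (fill C Q) (FunT \<upsilon> \<sigma>)" and N: "typing S [] N \<upsilon>"
    by (auto elim: typing_AppE)
  have "factors S I (\<lambda>M. App M N) (FunT \<upsilon> \<sigma>) \<sigma>"
    by (rule factorsI[of _ _ "\<lambda>h. bindD I (tyD I \<upsilon>) (tyD I \<sigma>) (tmD S I N [] \<upsilon> []) (appD I \<upsilon> \<sigma> h)"])
      (auto intro: typing.ty_App bindD_closed appD_closed simp: N tmD_closed tmD_App[OF _ N]
        simp del: tyD.simps tmD.simps)
  moreover obtain \<tau> where "typing S [] Q \<tau>" "factors S I (fill C) \<tau> (FunT \<upsilon> \<sigma>)"
    using EAppL.IH EAppL.prems M by auto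
  ultimately show ?case using factors_comp by fastforce
next
  case (EAppR \<upsilon>' M C)
  then obtain \<upsilon> where L: "typing S [] (Lam \<upsilon>' M) (FunT \<upsilon> \<sigma>)" and N: "typing S [] (fill C Q) \<upsilon>"
    by (auto elim: typing_AppE)
  obtain h where h: "h \<in> tyD I (FunT \<upsilon> \<sigma>)"
      "tmD S I (Lam \<upsilon>' M) [] (FunT \<upsilon> \<sigma>) [] = eta I (tyD I (FunT \<upsilon> \<sigma>)) h"
    using value_denotes[OF is_value.intros(4) L] by blast
  have "factors S I (App (Lam \<upsilon>' M)) \<upsilon> \<sigma>"
    by (rule factorsI[of _ _ "appD I \<upsilon> \<sigma> h"])
      (auto intro: typing.ty_App L bindD_closed appD_closed
        simp: h bindD_eta bindD_closed tmD_closed appD_closed tmD_App[OF L] simp del: tyD.simps tmD.simps)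
  moreover obtain \<tau> where "typing S [] Q \<tau>" "factors S I (fill C) \<tau> \<upsilon>"
    using EAppR.IH EAppR.prems N by auto
  ultimately show ?case using factors_comp by fastforce
qed

text \<open>The parameters are constants, hence pure, so the term in the hole denotes an operation;
  \<open>opD_bind\<close> then moves the \<open>k\<close> of the factorisation into its
  branches.\<close>

lemma factors_op:
  assumes F: "factors S I F \<tau> \<sigma>" and op: "typing S [] (Op p (map Const cs) Ms) \<tau>"
  shows "map (constT S) cs = opPars S p" "length Ms = opArity S p" "\<forall>M \<in> set Ms. typing S [] (F M) \<sigma>"
    and "tmD S I (F (Op p (map Const cs) Ms)) [] \<sigma> [] =
      opD S I p (tyD I \<sigma>) (map (constD I) cs) (map (\<lambda>M. tmD S I (F M) [] \<sigma> []) Ms)"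
proof -
  from op show cs: "map (constT S) cs = opPars S p" and len: "length Ms = opArity S p"
    by (auto elim!: typing_OpE dest: typing_consts)
  from op have Ms: "\<forall>M \<in> set Ms. typing S [] M \<tau>"
    by (auto elim!: typing_OpE)
  obtain k where k: "k \<in> tyD I \<tau> \<rightarrow> T I (tyD I \<sigma>)" "\<And>Q. typing S [] Q \<tau> \<Longrightarrow> typing S [] (F Q) \<sigma>"
      "\<And>Q. typing S [] Q \<tau> \<Longrightarrow>
        tmD S I (F Q) [] \<sigma> [] = bindD I (tyD I \<tau>) (tyD I \<sigma>) (tmD S I Q [] \<tau> []) k"
    using F unfolding factors_def by blast
  show "\<forall>M \<in> set Ms. typing S [] (F M) \<sigma>" using k(2) Ms by blast
  have us: "\<forall>u \<in> set (map (\<lambda>M. tmD S I M [] \<tau> []) Ms). u \<in> T I (tyD I \<tau>)"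
    using Ms tmD_closed by auto
  have xs: "list_all2 (\<lambda>x b. x \<in> base I b) (map (constD I) cs) (opPars S p)"
    by (simp add: cs[symmetric] list_all2_conv_all_nth const_closed)
  have "tmD S I (Op p (map Const cs) Ms) [] \<tau> [] =
      opD S I p (tyD I \<tau>) (map (constD I) cs) (map (\<lambda>M. tmD S I M [] \<tau> []) Ms)"
    unfolding tmD_Op cs[symmetric]
    by (rule bindsD_consts) (rule opD_closed; use cs len us in auto)
  then show "tmD S I (F (Op p (map Const cs) Ms)) [] \<sigma> [] =
      opD S I p (tyD I \<sigma>) (map (constD I) cs) (map (\<lambda>M. tmD S I (F M) [] \<sigma> []) Ms)"
    using k Ms len by (simp add: k(3)[OF op] opD_bind[OF xs _ us] Pi_iff comp_def cong: map_cong)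
qed

text \<open>The typing of \<open>E\<close> is part of the claim because an effect value assembled
  from branches must be typed before its denotation can be computed.\<close>

lemma eff_eval_sound:
  "eff_eval S N E \<Longrightarrow> typing S [] N \<sigma> \<Longrightarrow> typing S [] E \<sigma> \<and> tmD S I E [] \<sigma> [] = tmD S I N [] \<sigma> []"
proof (induction arbitrary: \<sigma> rule: eff_eval.induct)
  case (1 V)
  then show ?case by simp
next
  case (2 M M' E)
  from 2(1) obtain C Q Q' where C: "M = fill C Q" "M' = fill C Q'" "is_ectx C" "redex S Q Q'"
    by (auto elim: step.cases)
  from fill_factors[OF C(3)] 2(4) obtain \<tau> where "typing S [] Q \<tau>" "factors S I (fill C) \<tau> \<sigma>"
    unfolding C(1) by blast
  with redex_sound[OF C(4)] have "typing S [] M' \<sigma> \<and> tmD S I M' [] \<sigma> [] = tmD S I M [] \<sigma> []"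
    unfolding C(1,2) factors_def by metis
  with 2(3) show ?case by metis
next
  case (3 C Ms Es p cs)
  from fill_factors[OF 3(1,3)] obtain \<tau> where op: "typing S [] (Op p (map Const cs) Ms) \<tau>"
    and F: "factors S I (fill C) \<tau> \<sigma>" by blast
  note * = factors_op[OF F op]
  have IH: "list_all2 (\<lambda>M E. typing S [] E \<sigma> \<and> tmD S I E [] \<sigma> [] = tmD S I (fill C M) [] \<sigma> []) Ms Es"
    using 3(2) *(3) by (auto simp: list_all2_conv_all_nth)
  have cs: "list_all2 (\<lambda>N b. typing S [] N (BaseT b)) (map Const cs) (opPars S p)"
    unfolding *(1)[symmetric] by (simp add: list_all2_conv_all_nth typing.ty_Const)
  have E: "typing S [] (Op p (map Const cs) Es) \<sigma>"
    using IH cs *(2) by (auto intro!: typing.ty_Op simp: list_all2_conv_all_nth in_set_conv_nth)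
  \<comment> \<open>Taken with the identity, \<open>factors_op\<close> also computes the denotation
    of the assembled effect value.\<close>
  have "factors S I (\<lambda>Q. Q) \<sigma> \<sigma>"
    by (rule factorsI[of _ _ "eta I (tyD I \<sigma>)"]) (simp_all add: eta_closed bindD_eta_right tmD_closed)
  from factors_op(4)[OF this E] have "tmD S I (Op p (map Const cs) Es) [] \<sigma> [] =
      opD S I p (tyD I \<sigma>) (map (constD I) cs) (map (\<lambda>E. tmD S I E [] \<sigma> []) Es)" .
  moreover have "map (\<lambda>E. tmD S I E [] \<sigma> []) Es = map (\<lambda>M. tmD S I (fill C M) [] \<sigma> []) Ms"
    using IH by (auto simp: list_all2_conv_all_nth intro!: nth_equalityI)
  ultimately show ?case using E *(4) by simp
qed

end

section \<open>Uniqueness of effect values\<close>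

text \<open>Only shapes count: the types of constants and the truth value of a condition do not
  affect how a term decomposes. Operations are included so that one uniqueness result also separates
  them from ordinary steps.\<close>

inductive active :: "('b, 'c, 'f, 'o) tm \<Rightarrow> bool" where
  "active (FApp f (map Const cs))"
| "active (Cond (Const c) M N)"
| "active (Op p (map Const cs) Ms)"
| "is_value V \<Longrightarrow> is_value W \<Longrightarrow> active (Fst (Pair V W))"
| "is_value V \<Longrightarrow> is_value W \<Longrightarrow> active (Snd (Pair V W))"
| "is_value V \<Longrightarrow> active (App (Lam \<sigma> M) V)"

inductive_cases is_value_FAppE: "is_value (FApp f Ms)"
inductive_cases is_value_CondE: "is_value (Cond L M N)"
inductive_cases is_value_OpE: "is_value (Op p Ns Ms)"
inductive_cases is_value_PairE: "is_value (Pair M N)"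
inductive_cases is_value_FstE: "is_value (Fst M)"
inductive_cases is_value_SndE: "is_value (Snd M)"
inductive_cases is_value_AppE: "is_value (App M N)"

lemmas is_value_elims = is_value_FAppE is_value_CondE is_value_OpE is_value_PairE is_value_FstE
  is_value_SndE is_value_AppE

lemma redex_active: "redex S Q Q' \<Longrightarrow> active Q"
  by (induction rule: redex.induct) (auto intro: active.intros)

text \<open>Pairing is the only frame that a value can have, and components of value pairs are
  values; an active term is none.\<close>

lemma fill_active_not_value: "active Q \<Longrightarrow> \<not> is_value (fill C Q)"
proof (induction C)
  case Hole
  then show ?case by (auto elim: active.cases elim!: is_value_elims)
qed (auto elim!: is_value_elims)

lemma fill_active_not_Const: "active Q \<Longrightarrow> fill C Q \<noteq> Const c"
  using fill_active_not_value is_value.intros(1) by metis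

lemma fill_active_not_Lam: "active Q \<Longrightarrow> fill C Q \<noteq> Lam \<sigma> M"
  using fill_active_not_value is_value.intros(4) by metis

lemma consts_append_ne:
  "(\<And>c. x \<noteq> Const c) \<Longrightarrow> map Const cs @ x # xs \<noteq> map Const ds"
proof (induction cs arbitrary: ds)
  case Nil
  then show ?case by (cases ds) auto
next
  case (Cons c cs)
  then show ?case by (cases ds) auto
qed

text \<open>The hole in an argument list stands at the first entry that is not a constant.\<close>

lemma consts_append_eq:
  "(\<And>c. x \<noteq> Const c) \<Longrightarrow> (\<And>c. y \<noteq> Const c) \<Longrightarrow>
    map Const cs @ x # xs = map Const ds @ y # ys \<Longrightarrow> cs = ds \<and> x = y \<and> xs = ys"
proof (induction cs arbitrary: ds)
  case Nil
  then show ?case by (cases ds) auto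
next
  case (Cons c cs)
  then obtain ds' where "ds = c # ds'" by (cases ds) (use Cons.prems(2)[of c] in auto)
  with Cons show ?case by simp
qed

text \<open>The evaluated positions of an active term already hold values, so a proper context would
  have a value where it holds an active subterm.\<close>

lemma active_fill_Hole:
  assumes "active (fill D R)" "active R"
  shows "D = Hole"
proof (cases D)
  case (EFApp f cs C Ms)
  then show ?thesis
    using assms consts_append_ne[OF fill_active_not_Const[OF assms(2)]]
    by (auto elim: active.cases)
next
  case (ECond C M N)
  then show ?thesis
    using assms fill_active_not_Const[OF assms(2)] by (auto elim: active.cases)
next
  case (EOp p cs C Ns Ms)
  then show ?thesis
    using assms consts_append_ne[OF fill_active_not_Const[OF assms(2)]]
    by (auto elim: active.cases)
next
  case (EFst C)
  have "is_value (fill C R)"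
    using assms(1)[unfolded EFst fill.simps] by cases (auto intro: is_value.intros)
  then show ?thesis using fill_active_not_value[OF assms(2)] by blast
next
  case (ESnd C)
  have "is_value (fill C R)"
    using assms(1)[unfolded ESnd fill.simps] by cases (auto intro: is_value.intros)
  then show ?thesis using fill_active_not_value[OF assms(2)] by blast
next
  case (EAppL C N)
  then show ?thesis
    using assms fill_active_not_Lam[OF assms(2)] by (auto elim: active.cases)
next
  case (EAppR \<sigma> M C)
  have "is_value (fill C R)"
    using assms(1)[unfolded EAppR fill.simps] by cases auto
  then show ?thesis using fill_active_not_value[OF assms(2)] by blast
qed (use assms in \<open>auto elim: active.cases\<close>)

text \<open>Competing frames are decided by the first non-value. For pairs this uses that
  \<open>is_ectx\<close> demands a value on the left of \<open>EPairR\<close>, for applications that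
  a filled hole is never a lambda abstraction.\<close>

lemma decomposition_unique:
  assumes Q: "active Q" and R: "active R"
  shows "is_ectx C \<Longrightarrow> is_ectx D \<Longrightarrow> fill C Q = fill D R \<Longrightarrow> C = D \<and> Q = R"
proof (induction C arbitrary: D)
  case Hole
  then show ?case using active_fill_Hole[of D R] Q R by auto
next
  case (EFApp f cs C Ms)
  have "D \<noteq> Hole"
    using active_fill_Hole[of "EFApp f cs C Ms" Q] Q R EFApp.prems(3) by auto
  then show ?case using EFApp by (cases D) (auto dest!: consts_append_eq[OF fill_active_not_Const[OF Q] fill_active_not_Const[OF R]])
next
  case (ECond C M N)
  have "D \<noteq> Hole"
    using active_fill_Hole[of "ECond C M N" Q] Q R ECond.prems(3) by auto
  then show ?case using ECond by (cases D) auto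
next
  case (EOp p cs C Ns Ms)
  have "D \<noteq> Hole"
    using active_fill_Hole[of "EOp p cs C Ns Ms" Q] Q R EOp.prems(3) by auto
  then show ?case using EOp by (cases D) (auto dest!: consts_append_eq[OF fill_active_not_Const[OF Q] fill_active_not_Const[OF R]])
next
  case (EPairL C N)
  have "D \<noteq> Hole"
    using active_fill_Hole[of "EPairL C N" Q] Q R EPairL.prems(3) by auto
  then show ?case using EPairL fill_active_not_value[OF Q] by (cases D) auto
next
  case (EPairR V C)
  have "D \<noteq> Hole"
    using active_fill_Hole[of "EPairR V C" Q] Q R EPairR.prems(3) by auto
  then show ?case using EPairR fill_active_not_value[OF R] by (cases D) auto
next
  case (EFst C)
  have "D \<noteq> Hole"
    using active_fill_Hole[of "EFst C" Q] Q R EFst.prems(3) by auto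
  then show ?case using EFst by (cases D) auto
next
  case (ESnd C)
  have "D \<noteq> Hole"
    using active_fill_Hole[of "ESnd C" Q] Q R ESnd.prems(3) by auto
  then show ?case using ESnd by (cases D) auto
next
  case (EAppL C N)
  have "D \<noteq> Hole"
    using active_fill_Hole[of "EAppL C N" Q] Q R EAppL.prems(3) by auto
  then show ?case using EAppL fill_active_not_Lam[OF Q] by (cases D) auto
next
  case (EAppR \<sigma> M C)
  have "D \<noteq> Hole"
    using active_fill_Hole[of "EAppR \<sigma> M C" Q] Q R EAppR.prems(3) by auto
  then show ?case using EAppR fill_active_not_Lam[OF R, symmetric] by (cases D) auto
qed

lemma inj_map_Const: "map Const cs = map Const ds \<longleftrightarrow> cs = ds"
  by (rule inj_map_eq_map) (simp add: inj_def)

lemma redex_unique: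
  "redex S Q R \<Longrightarrow> redex S Q R' \<Longrightarrow> ttC S \<noteq> ffC S \<Longrightarrow> R = R'"
  by (erule redex.cases; erule redex.cases) (auto simp: inj_map_Const)

lemma not_redex_Op: "\<not> redex S (Op p Ns Ms) R"
  by (auto elim: redex.cases)

lemma eff_eval_unique:
  assumes ne: "ttC S \<noteq> ffC S"
  shows "eff_eval S M E \<Longrightarrow> eff_eval S M E' \<Longrightarrow> E = E'"
proof (induction arbitrary: E' rule: eff_eval.induct)
  case (1 V)
  have "\<not> step S V M'" for M'
    using fill_active_not_value[OF redex_active] 1(1) by (blast elim: step.cases)
  moreover have "V \<noteq> fill C (Op p (map Const cs) Ms)" for C p cs Ms
    using fill_active_not_value[OF active.intros(3)] 1(1) by metis
  ultimately show ?case
    using 1(2) by (metis (lifting) eff_eval.cases)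
next
  case (2 M M' E)
  from 2(1) obtain C Q Q' where C: "M = fill C Q" "M' = fill C Q'" "is_ectx C" "redex S Q Q'"
    by (auto elim: step.cases)
  note Q = redex_active[OF C(4)]
  from 2(4) show ?case
  proof cases
    case 1
    then show ?thesis using fill_active_not_value[OF Q] C(1) by blast
  next
    case (2 M1)
    from 2(1) obtain D R R' where D: "M = fill D R" "M1 = fill D R'" "is_ectx D" "redex S R R'"
      by (auto elim: step.cases)
    have "C = D \<and> Q = R"
      by (rule decomposition_unique[OF Q redex_active[OF D(4)] C(3) D(3)]) (use C(1) D(1) in simp)
    then have "M1 = M'" using C D redex_unique[OF _ _ ne] by blast
    then show ?thesis using "2.IH" 2(2) by simp
  next
    case (3 D Ms Es p cs)
    have "Q = Op p (map Const cs) Ms"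
      using decomposition_unique[OF Q active.intros(3) C(3) 3(3)] C(1) 3(1) by metis
    then show ?thesis using C(4) not_redex_Op by metis
  qed
next
  case (3 C Ms Es p cs)
  from 3(3) show ?case
  proof cases
    case 1
    then show ?thesis using fill_active_not_value[OF active.intros(3)] by metis
  next
    case (2 M1)
    from 2(1) obtain D R R' where D: "fill C (Op p (map Const cs) Ms) = fill D R" "is_ectx D" "redex S R R'"
      by (auto elim: step.cases)
    have "Op p (map Const cs) Ms = R"
      using decomposition_unique[OF active.intros(3) redex_active[OF D(3)] 3(1) D(2,1)] by blast
    then show ?thesis using D(3) not_redex_Op by metis
  next
    case (3 D Ms' Es' p' cs')
    have "C = D \<and> Op p (map Const cs) Ms = Op p' (map Const cs') Ms'"
      using decomposition_unique[OF active.intros(3) active.intros(3) "3.hyps"(1) 3(3,1)] .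
    then have *: "C = D" "p = p'" "cs = cs'" "Ms = Ms'" by (auto simp: inj_map_Const)
    have "Es = Es'"
      using "3.IH" 3(4) unfolding * by (auto simp: list_all2_conv_all_nth intro: nth_equalityI)
    then show ?thesis using * 3(2) by simp
  qed
qed

section \<open>Existence of effect values\<close>

primrec ectx_comp ::
  "('b, 'c, 'f, 'o) ectx \<Rightarrow> ('b, 'c, 'f, 'o) ectx \<Rightarrow> ('b, 'c, 'f, 'o) ectx" where
  "ectx_comp Hole D = D"
| "ectx_comp (EFApp f cs C Ms) D = EFApp f cs (ectx_comp C D) Ms"
| "ectx_comp (ECond C M N) D = ECond (ectx_comp C D) M N"
| "ectx_comp (EOp p cs C Ns Ms) D = EOp p cs (ectx_comp C D) Ns Ms"
| "ectx_comp (EPairL C N) D = EPairL (ectx_comp C D) N"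
| "ectx_comp (EPairR V C) D = EPairR V (ectx_comp C D)"
| "ectx_comp (EFst C) D = EFst (ectx_comp C D)"
| "ectx_comp (ESnd C) D = ESnd (ectx_comp C D)"
| "ectx_comp (EAppL C N) D = EAppL (ectx_comp C D) N"
| "ectx_comp (EAppR \<sigma> M C) D = EAppR \<sigma> M (ectx_comp C D)"

lemma fill_ectx_comp: "fill (ectx_comp C D) M = fill C (fill D M)"
  by (induction C) auto

lemma is_ectx_comp: "is_ectx C \<Longrightarrow> is_ectx D \<Longrightarrow> is_ectx (ectx_comp C D)"
  by (induction C) auto

lemma step_fill:
  assumes "step S M M'" "is_ectx C"
  shows "step S (fill C M) (fill C M')"
proof -
  obtain D Q Q' where "M = fill D Q" "M' = fill D Q'" "is_ectx D" "redex S Q Q'"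
    using assms(1) by (auto elim: step.cases)
  then show ?thesis
    using step.intros[OF is_ectx_comp[OF assms(2)], of D S Q Q'] by (simp add: fill_ectx_comp)
qed

lemma redex_step: "redex S Q Q' \<Longrightarrow> step S Q Q'"
  using step.intros[of Hole S Q Q'] by simp

text \<open>The condition on end points is a parameter, so that reducibility at function types can
  be defined by recursion on the type. Following some step instead of all steps is enough, since
  only existence is at stake.\<close>

inductive reduces ::
  "('b, 'c, 'f, 'o) signature \<Rightarrow> (('b, 'c, 'f, 'o) tm \<Rightarrow> bool) \<Rightarrow> ('b, 'c, 'f, 'o) tm \<Rightarrow> bool"
  for S P where
  reduces_base: "P V \<Longrightarrow> reduces S P V"
| reduces_step: "step S M M' \<Longrightarrow> reduces S P M' \<Longrightarrow> reduces S P M"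
| reduces_op: "is_ectx C \<Longrightarrow> (\<And>M. M \<in> set Ms \<Longrightarrow> reduces S P (fill C M)) \<Longrightarrow>
    reduces S P (fill C (Op p (map Const cs) Ms))"

text \<open>The counterpart of Kleisli extension for evaluation trees: trees for
  \<open>fill D V\<close> are grafted onto the leaves \<open>V\<close> of the tree of
  \<open>M\<close>. Since contexts compose, operations met on the way stay in evaluation
  position.\<close>

lemma reduces_fill:
  assumes D: "is_ectx D" and Q: "\<And>V. P V \<Longrightarrow> reduces S Q (fill D V)"
  shows "reduces S P M \<Longrightarrow> reduces S Q (fill D M)"
proof (induction rule: reduces.induct)
  case (reduces_base V)
  then show ?case by (rule Q)
next
  case (reduces_step M M')
  then show ?case using step_fill[OF _ D] reduces.reduces_step by blast
next
  case (reduces_op C Ms p cs)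
  then show ?case
    using reduces.reduces_op[OF is_ectx_comp[OF D reduces_op(1)], of Ms S Q p cs]
    by (simp add: fill_ectx_comp)
qed

lemma reduces_eff_eval:
  assumes "\<And>V. P V \<Longrightarrow> is_value V"
  shows "reduces S P M \<Longrightarrow> \<exists>E. eff_eval S M E"
proof (induction rule: reduces.induct)
  case (reduces_base V)
  then show ?case using assms eff_eval.intros(1) by blast
next
  case (reduces_step M M')
  then show ?case using eff_eval.intros(2) by blast
next
  case (reduces_op C Ms p cs)
  then have "\<forall>M \<in> set Ms. \<exists>E. eff_eval S (fill C M) E" by blast
  from bchoice[OF this] obtain E where "\<forall>M \<in> set Ms. eff_eval S (fill C M) (E M)" ..
  then have "list_all2 (\<lambda>M E. eff_eval S (fill C M) E) Ms (map E Ms)"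
    by (simp add: list_all2_conv_all_nth)
  then show ?case using eff_eval.intros(3)[OF reduces_op(1)] by blast
qed

text \<open>Typing is demanded at function types only, because at the other types it follows. It
  makes reducible values closed, so that successive substitutions do not interfere.\<close>

primrec red_value ::
  "('b, 'c, 'f, 'o) signature \<Rightarrow> 'b ty \<Rightarrow> ('b, 'c, 'f, 'o) tm \<Rightarrow> bool" where
  "red_value S (BaseT b) V \<longleftrightarrow> (\<exists>c. V = Const c \<and> constT S c = b)"
| "red_value S UnitT V \<longleftrightarrow> V = Star"
| "red_value S (ProdT \<sigma> \<tau>) V \<longleftrightarrow> (\<exists>V1 V2. V = Pair V1 V2 \<and> red_value S \<sigma> V1 \<and> red_value S \<tau> V2)"
| "red_value S (FunT \<sigma> \<tau>) V \<longleftrightarrow> typing S [] V (FunT \<sigma> \<tau>) \<and>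
    (\<exists>M. V = Lam \<sigma> M \<and> (\<forall>W. red_value S \<sigma> W \<longrightarrow> reduces S (red_value S \<tau>) (subst M 0 W)))"

lemma red_value_typing: "red_value S \<sigma> V \<Longrightarrow> typing S [] V \<sigma>"
  by (induction \<sigma> arbitrary: V) (auto intro: typing.intros)

lemma red_value_is_value: "red_value S \<sigma> V \<Longrightarrow> is_value V"
  by (induction \<sigma> arbitrary: V) (auto intro: is_value.intros)

text \<open>The index \<open>k\<close> is substituted last, so that the substitution for a lambda body followed by a
  \<beta>-reduction is again of this form.\<close>

primrec subst_list ::
  "nat \<Rightarrow> ('b, 'c, 'f, 'o) tm list \<Rightarrow> ('b, 'c, 'f, 'o) tm \<Rightarrow> ('b, 'c, 'f, 'o) tm" where
  "subst_list k [] M = M"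
| "subst_list k (V # Vs) M = subst (subst_list (Suc k) Vs M) k V"

lemma subst_list_Nil [simp]: "subst_list k [] = (\<lambda>M. M)"
  by (simp add: fun_eq_iff)

lemma subst_list_simps [simp]:
  "subst_list k Vs (Const c) = Const c"
  "subst_list k Vs (FApp f Ms) = FApp f (map (subst_list k Vs) Ms)"
  "subst_list k Vs (Cond L M N) = Cond (subst_list k Vs L) (subst_list k Vs M) (subst_list k Vs N)"
  "subst_list k Vs (Op p Ns Ms) = Op p (map (subst_list k Vs) Ns) (map (subst_list k Vs) Ms)"
  "subst_list k Vs Star = Star"
  "subst_list k Vs (Pair M N) = Pair (subst_list k Vs M) (subst_list k Vs N)"
  "subst_list k Vs (Fst M) = Fst (subst_list k Vs M)"
  "subst_list k Vs (Snd M) = Snd (subst_list k Vs M)"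
  "subst_list k Vs (App M N) = App (subst_list k Vs M) (subst_list k Vs N)"
  by (induction Vs arbitrary: k) (simp_all add: comp_def)

lemma subst_list_Lam:
  "list_all2 (typing S []) Vs \<Gamma> \<Longrightarrow> subst_list k Vs (Lam \<sigma> M) = Lam \<sigma> (subst_list (Suc k) Vs M)"
  by (induction arbitrary: k rule: list_all2_induct) (simp_all add: lift_typed)

lemma subst_list_Var_less: "i < k \<Longrightarrow> subst_list k Vs (Var i) = Var i"
  by (induction Vs arbitrary: k) simp_all

text \<open>The inserted value is closed, so the later substitutions for smaller indices leave it
  alone.\<close>

lemma subst_list_Var:
  "list_all2 (typing S []) Vs \<Gamma> \<Longrightarrow> i < length Vs \<Longrightarrow> subst_list k Vs (Var (k + i)) = Vs ! i"
proof (induction arbitrary: k i rule: list_all2_induct)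
  case (Cons V Vs \<sigma> \<Gamma>)
  show ?case
  proof (cases i)
    case 0
    then show ?thesis by (simp add: subst_list_Var_less)
  next
    case (Suc j)
    then have "subst_list (Suc k) Vs (Var (k + i)) = Vs ! j" "typing S [] (Vs ! j) (\<Gamma> ! j)"
      using Cons.IH[of j "Suc k"] Cons.hyps Cons.prems by (simp_all add: list_all2_conv_all_nth)
    then show ?thesis using Suc by (simp add: subst_typed)
  qed
qed simp

lemma typing_subst_list:
  "list_all2 (typing S []) Vs \<Gamma> \<Longrightarrow> typing S (\<Delta> @ \<Gamma>) M \<sigma> \<Longrightarrow>
    typing S \<Delta> (subst_list (length \<Delta>) Vs M) \<sigma>"
proof (induction arbitrary: \<Delta> rule: list_all2_induct)
  case (Cons V Vs \<upsilon> \<Gamma>)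
  then show ?case using Cons.IH[of "\<Delta> @ [\<upsilon>]"] by (auto intro: typing_subst)
qed simp

text \<open>\<open>ds\<close> collects the arguments already evaluated. \<open>F\<close> stands for
  \<open>FApp f\<close> or for \<open>Op p\<close> with fixed branches.\<close>

lemma reduces_args:
  assumes F: "\<And>cs Ms. \<exists>D. is_ectx D \<and> (\<forall>N. F (map Const cs @ N # Ms) = fill D N)"
    and "list_all2 (\<lambda>M b. reduces S (red_value S (BaseT b)) M) Ms bs"
    and "\<And>cs. map (constT S) cs = map (constT S) ds @ bs \<Longrightarrow> reduces S P (F (map Const cs))"
  shows "reduces S P (F (map Const ds @ Ms))"
  using assms(2,3)
proof (induction arbitrary: ds rule: list_all2_induct)
  case Nil
  then show ?case by simp
next
  case (Cons M Ms b bs)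
  obtain D where D: "is_ectx D" "\<And>N. F (map Const ds @ N # Ms) = fill D N"
    using F by blast
  have "reduces S P (fill D V)" if V: "red_value S (BaseT b) V" for V
  proof -
    from V obtain c where c: "V = Const c" "constT S c = b" by auto
    have "reduces S P (F (map Const (ds @ [c]) @ Ms))"
      by (rule Cons.IH) (use Cons.prems c in simp)
    then show ?thesis using D(2)[of V] c by simp
  qed
  from reduces_fill[OF D(1) this Cons.hyps(1)] show ?case using D(2) by simp
qed

section \<open>The fundamental lemma of reducibility\<close>

context language
begin

lemma typing_reduces:
  assumes bool: "\<And>c. constT S c = boolT S \<Longrightarrow> c = ttC S \<or> c = ffC S"
  shows "typing S \<Gamma> M \<sigma> \<Longrightarrow> list_all2 (\<lambda>V \<sigma>. red_value S \<sigma> V) Vs \<Gamma> \<Longrightarrow>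
    reduces S (red_value S \<sigma>) (subst_list 0 Vs M)"
proof (induction arbitrary: Vs rule: typing.induct)
  case (ty_Var i \<Gamma>)
  then have "list_all2 (typing S []) Vs \<Gamma>"
    by (auto elim!: list_all2_mono intro: red_value_typing)
  from subst_list_Var[OF this, of i 0] ty_Var show ?case
    by (auto simp: list_all2_conv_all_nth intro: reduces_base)
next
  case (ty_Const \<Gamma> c)
  then show ?case by (simp add: reduces_base)
next
  case (ty_FApp \<Gamma> Ms f)
  have "reduces S (red_value S (BaseT (funRes S f))) (FApp f (map Const [] @ map (subst_list 0 Vs) Ms))"
  proof (rule reduces_args)
    show "list_all2 (\<lambda>M b. reduces S (red_value S (BaseT b)) M) (map (subst_list 0 Vs) Ms) (funArgs S f)"
      using ty_FApp by (auto simp: list_all2_map1 simp del: red_value.simps elim!: list_all2_mono)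
    show "\<exists>D. is_ectx D \<and> (\<forall>N. FApp f (map Const cs @ N # Ms) = fill D N)" for cs Ms
      by (rule exI[of _ "EFApp f cs Hole Ms"]) simp
  next
    fix cs assume "map (constT S) cs = map (constT S) [] @ funArgs S f"
    then have cs: "map (constT S) cs = funArgs S f" by simp
    show "reduces S (red_value S (BaseT (funRes S f))) (FApp f (map Const cs))"
      by (rule reduces_step[OF redex_step[OF redex.intros(1)[OF cs]]])
        (rule reduces_base, simp add: val_type[OF cs])
  qed
  then show ?case by (simp del: red_value.simps)
next
  case (ty_Cond \<Gamma> L M \<sigma> N)
  let ?M = "subst_list 0 Vs M" and ?N = "subst_list 0 Vs N"
  have "reduces S (red_value S \<sigma>) (fill (ECond Hole ?M ?N) (subst_list 0 Vs L))"
  proof (rule reduces_fill)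
    fix V assume "red_value S (BaseT (boolT S)) V"
    then obtain c where "V = Const c" "c = ttC S \<or> c = ffC S" using bool by auto
    \<comment> \<open>It is immaterial which branch is taken, as both are reducible.\<close>
    then have "step S (Cond V ?M ?N) ?M \<or> step S (Cond V ?M ?N) ?N"
      by (auto intro: redex_step redex.intros)
    then show "reduces S (red_value S \<sigma>) (fill (ECond Hole ?M ?N) V)"
      using ty_Cond.IH(2,3)[OF ty_Cond.prems] by (auto intro: reduces_step)
  qed (use ty_Cond in simp_all)
  then show ?case by simp
next
  case (ty_Op \<Gamma> Ns p Ms \<sigma>)
  let ?Ms = "map (subst_list 0 Vs) Ms"
  have "reduces S (red_value S \<sigma>) (Op p (map Const [] @ map (subst_list 0 Vs) Ns) ?Ms)"
  proof (rule reduces_args)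
    show "list_all2 (\<lambda>M b. reduces S (red_value S (BaseT b)) M) (map (subst_list 0 Vs) Ns) (opPars S p)"
      using ty_Op by (auto simp: list_all2_map1 simp del: red_value.simps elim!: list_all2_mono)
    show "\<exists>D. is_ectx D \<and> (\<forall>N. Op p (map Const cs @ N # Ns) ?Ms = fill D N)" for cs Ns
      by (rule exI[of _ "EOp p cs Hole Ns ?Ms"]) simp
  next
    fix cs
    have "reduces S (red_value S \<sigma>) (fill Hole (Op p (map Const cs) ?Ms))"
      by (rule reduces_op) (use ty_Op in auto)
    then show "reduces S (red_value S \<sigma>) (Op p (map Const cs) ?Ms)" by simp
  qed
  then show ?case by simp
next
  case (ty_Star \<Gamma>)
  then show ?case by (simp add: reduces_base)
next
  case (ty_Pair \<Gamma> M \<sigma> N \<tau>)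
  let ?P = "red_value S (ProdT \<sigma> \<tau>)" and ?M = "subst_list 0 Vs M" and ?N = "subst_list 0 Vs N"
  have "reduces S ?P (fill (EPairL Hole ?N) ?M)"
  proof (rule reduces_fill)
    fix V assume V: "red_value S \<sigma> V"
    have "reduces S ?P (fill (EPairR V Hole) ?N)"
    proof (rule reduces_fill)
      fix W assume "red_value S \<tau> W"
      with V show "reduces S ?P (fill (EPairR V Hole) W)"
        by (auto intro: reduces_base)
    qed (use ty_Pair V in \<open>simp_all add: red_value_is_value\<close>)
    then show "reduces S ?P (fill (EPairL Hole ?N) V)" by simp
  qed (use ty_Pair in simp_all)
  then show ?case by (simp del: red_value.simps)
next
  case (ty_Fst \<Gamma> M \<sigma> \<tau>)
  have "reduces S (red_value S \<sigma>) (fill (EFst Hole) (subst_list 0 Vs M))"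
  proof (rule reduces_fill)
    fix V assume "red_value S (ProdT \<sigma> \<tau>) V"
    then obtain V1 V2 where "V = Pair V1 V2" "red_value S \<sigma> V1" "red_value S \<tau> V2" by auto
    moreover from this have "step S (Fst V) V1"
      by (auto intro!: redex_step redex.intros intro: red_value_is_value)
    ultimately show "reduces S (red_value S \<sigma>) (fill (EFst Hole) V)"
      by (auto intro: reduces_step reduces_base)
  qed (use ty_Fst in simp_all)
  then show ?case by (simp del: red_value.simps)
next
  case (ty_Snd \<Gamma> M \<sigma> \<tau>)
  have "reduces S (red_value S \<tau>) (fill (ESnd Hole) (subst_list 0 Vs M))"
  proof (rule reduces_fill)
    fix V assume "red_value S (ProdT \<sigma> \<tau>) V"
    then obtain V1 V2 where "V = Pair V1 V2" "red_value S \<sigma> V1" "red_value S \<tau> V2" by auto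
    moreover from this have "step S (Snd V) V2"
      by (auto intro!: redex_step redex.intros intro: red_value_is_value)
    ultimately show "reduces S (red_value S \<tau>) (fill (ESnd Hole) V)"
      by (auto intro: reduces_step reduces_base)
  qed (use ty_Snd in simp_all)
  then show ?case by (simp del: red_value.simps)
next
  case (ty_Lam \<sigma> \<Gamma> M \<tau>)
  then have Vs: "list_all2 (typing S []) Vs \<Gamma>"
    by (auto elim!: list_all2_mono intro: red_value_typing)
  have "typing S [] (subst_list 0 Vs (Lam \<sigma> M)) (FunT \<sigma> \<tau>)"
    using typing_subst_list[OF Vs, of "[]"] typing.ty_Lam[OF ty_Lam.hyps] by simp
  moreover have "reduces S (red_value S \<tau>) (subst (subst_list (Suc 0) Vs M) 0 W)"
    if "red_value S \<sigma> W" for W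
    \<comment> \<open>Substituting \<open>W\<close> last is, by the order built into
      \<open>subst_list\<close>, the substitution of \<open>W # Vs\<close>.\<close>
    using ty_Lam.IH[of "W # Vs"] ty_Lam.prems that by simp
  ultimately show ?case by (auto simp: subst_list_Lam[OF Vs] intro!: reduces_base)
next
  case (ty_App \<Gamma> M \<sigma> \<tau> N)
  let ?M = "subst_list 0 Vs M" and ?N = "subst_list 0 Vs N"
  have "reduces S (red_value S \<tau>) (fill (EAppL Hole ?N) ?M)"
  proof (rule reduces_fill)
    fix V assume "red_value S (FunT \<sigma> \<tau>) V"
    then obtain L where L: "V = Lam \<sigma> L"
        "\<And>W. red_value S \<sigma> W \<Longrightarrow> reduces S (red_value S \<tau>) (subst L 0 W)"
      by auto
    have "reduces S (red_value S \<tau>) (fill (EAppR \<sigma> L Hole) ?N)"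
    proof (rule reduces_fill)
      fix W assume W: "red_value S \<sigma> W"
      then have "step S (App (Lam \<sigma> L) W) (subst L 0 W)"
        by (intro redex_step redex.intros(6) red_value_is_value)
      then show "reduces S (red_value S \<tau>) (fill (EAppR \<sigma> L Hole) W)"
        using L(2)[OF W] by (auto intro: reduces_step)
    qed (use ty_App in simp_all)
    then show "reduces S (red_value S \<tau>) (fill (EAppL Hole ?N) V)" by (simp add: L(1))
  qed (use ty_App in simp_all)
  then show ?case by simp
qed

end

context set_model
begin

lemma tt_neq_ff: "ttC S \<noteq> ffC S"
  using const_tt const_ff num_inj by (metis injD zero_neq_one)

text \<open>Both elements of Bool are already denoted by \<open>ttC S\<close> and
  \<open>ffC S\<close>, so a third constant would share its denotation with one of them.\<close>

lemma bool_consts: "constT S c = boolT S \<Longrightarrow> c = ttC S \<or> c = ffC S"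
  using const_closed[of c] const_distinct[of c "ttC S"] const_distinct[of c "ffC S"]
  by (auto simp: base_bool const_tt const_ff tt_type ff_type)

end

theorem theorem3p6:
  fixes S :: "('b, 'c, 'f, 'o) signature"
    and I :: "('b, 'c, 'f, 'o, 'u, 't) model"
    and N :: "('b, 'c, 'f, 'o) tm"
    and \<sigma> :: "'b ty"
  assumes "set_model S I"
    and "typing S [] N \<sigma>"
  shows "denotation S I [] N \<sigma> = denotation S I [] (effect_value S N) \<sigma>"
proof -
  interpret set_model S I by fact
  obtain E where E: "eff_eval S N E"
    using reduces_eff_eval[of "red_value S \<sigma>"] red_value_is_value
      typing_reduces[OF bool_consts assms(2), of "[]"] by fastforce
  then have "effect_value S N = E"
    unfolding effect_value_def using eff_eval_unique[OF tt_neq_ff] by blast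
  \<comment> \<open>The empty context has only the empty environment, which is the one used in
    \<open>eff_eval_sound\<close>.\<close>
  then show ?thesis
    using eff_eval_sound[OF E assms(2)] by (auto simp: denotation_def intro!: restrict_ext)
qed

end
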